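(* Let $(J_1,J_2) \subseteq (X_1,X_2)$ be pairs of a Banach space and a subspace, and assume that $J_1$ is an $M$-ideal in $X_1$. The following are equivalent: (i) $(J_1,J_2)$ is a simultaneous $M$-ideal in $(X_1,X_2)$. (ii) For all $n\in\mathbb{N}$, whenever $x_1,\dots,x_n \in X_1$ and positive numbers $r_1,\dots,r_n$ satisfy $$B(x_i,r_i)\cap J_1 \neq \emptyset \ \text{ for each } i=1,\dots,n \quad\text{and}\quad \bigcap_{i=1}^n B(x_i,r_i)\cap X_2 \neq\emptyset,$$ it follows that for every $\varepsilon>0$, $$\bigcap_{i=1}^n B(x_i,r_i+\varepsilon)\cap J_2\neq\emptyset.$$ (iii) The condition in (ii) holds for $n=3$, that is: whenever $x_1,x_2,x_3\in X_1$ and positive numbers $r_1,r_2,r_3$ satisfy $B(x_i,r_i)\cap J_1\neq\emptyset$ for $i=1,2,3$ and $\bigcap_{i=1}^3 B(x_i,r_i)\cap X_2\neq\emptyset$, it follows that $\bigcap_{i=1}^3 B(x_i,r_i+\varepsilon)\cap J_2\neq\emptyset$ for every $\varepsilon>0$. (iv) For all $y_1,y_2,y_3\in B_{J_1}$, all $x\in B_{X_2}$ and all $\varepsilon>0$ there is $y\in J_2$ satisfying $\|x+y_i-y\|\le 1+\varepsilon$ for $i=1,2,3$. (v) For all $n\in\mathbb{N}$, whenever $x_1,\dots,x_n\in X_1$ and positive numbers $r_1,\dots,r_n$ satisfy $$B(x_i,r_i)\cap J_1\neq\emptyset \ \text{ for each } i=1,\dots,n \quad\text{and}\quad \operatorname{int}\Big(\bigcap_{i=1}^n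 B(x_i,r_i)\Big)\cap X_2\neq\emptyset,$$ it follows that for every $\varepsilon>0$, $$\bigcap_{i=1}^n B(x_i,r_i+\varepsilon)\cap J_2\neq\emptyset.$$
   Context: A pair of a Banach space and a subspace $(X_1,X_2)$ consists of a Banach space $X_1$ and a closed subspace $X_2\subseteq X_1$. For two such pairs, $(J_1,J_2)\subseteq(X_1,X_2)$ means $J_1\subseteq X_1$ and $J_2\subseteq X_2$. The annihilator $J_k^\perp$ is taken in $X_k^*$ ($k=1,2$). $B(x,r)=\{y\in X_1: \|x-y\|\le r\}$ is the closed ball in $X_1$, $B_X$ is the closed unit ball of a Banach space $X$, and $\operatorname{int}$ denotes the interior in $X_1$. A linear projection $P:X\to X$ on a Banach space is an $L$-projection if $\|x\|=\|Px\|+\|x-Px\|$ for all $x\in X$. A closed subspace $J\subseteq X$ is an $M$-ideal in $X$ if $J^\perp$ is the range of an $L$-projection on $X^*$ (this projection is then unique). $(J_1,J_2)$ is a simultaneous $M$-ideal in $(X_1,X_2)$ if $J_1$ is an $M$-ideal in $X_1$, $J_2$ is an $M$-ideal in $X_2$, and the associated $L$-projections $Q_1:X_1^*\to J_1^\perp$ (onto $J_1^\perp$) and $Q_2:X_2^*\to J_2^\perp$ (onto $J_2^\perp$) satisfy $r\circ Q_1=Q_2\circ r$, where $r:X_1^*\to X_2^*$ is the restriction map. *)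

theory Defs
  imports "HOL-Analysis.Analysis" "HOL-Library.Function_Algebras"
begin

text \<open>
  Scalars: a type of sort \<open>{real_normed_field, euclidean_space}\<close> is a finite-dimensional commutative
  real division algebra with multiplicative norm, i.e. (isometrically) the reals or the complex
  numbers.  The locale equips a real Banach space type with a compatible action of these scalars,
  so that real and complex Banach spaces are covered uniformly.
\<close>

locale banach_over = vector_space smul
  for smul :: "'k::{real_normed_field, euclidean_space} \<Rightarrow> 'a::banach \<Rightarrow> 'a" +
  assumes scale_of_real: "smul (of_real t) x = t *\<^sub>R x"
    and norm_scale: "norm (smul c x) = norm c * norm x"

lemma banach_over_real: "banach_over ((*\<^sub>R) :: real \<Rightarrow> 'a::banach \<Rightarrow> 'a)"
  by unfold_locales (simp_all add: scaleR_add_right scaleR_add_left)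

lemma banach_over_complex: "banach_over ((*) :: complex \<Rightarrow> complex \<Rightarrow> complex)"
  by unfold_locales (simp_all add: algebra_simps norm_mult scaleR_conv_of_real)

definition closed_subspace ::
    "('k::{real_normed_field, euclidean_space} \<Rightarrow> 'a::banach \<Rightarrow> 'a) \<Rightarrow> 'a set \<Rightarrow> bool" where
  "closed_subspace smul X \<longleftrightarrow> module.subspace smul X \<and> closed X"

text \<open>
  The dual of a subspace \<open>X\<close>, viewed as a normed space in its own right.  A functional on \<open>X\<close> is
  represented by its extension by \<open>0\<close> to the whole type, so that functionals on \<open>X\<close> are equal
  iff they agree on \<open>X\<close>, and the vector space operations are the pointwise ones.  The extended
  function is in general not linear outside \<open>X\<close>.
\<close>

definition dual_space ::
    "('k::{real_normed_field, euclidean_space} \<Rightarrow> 'a::banach \<Rightarrow> 'a) \<Rightarrow> 'a set \<Rightarrow> ('a \<Rightarrow> 'k) set" where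
  "dual_space smul X =
     {f. (\<forall>x\<in>X. \<forall>y\<in>X. f (x + y) = f x + f y) \<and>
         (\<forall>c. \<forall>x\<in>X. f (smul c x) = c * f x) \<and>
         (\<exists>B. \<forall>x\<in>X. norm (f x) \<le> B * norm x) \<and>
         (\<forall>x. x \<notin> X \<longrightarrow> f x = 0)}"

definition dual_scale :: "'k \<Rightarrow> ('a \<Rightarrow> 'k) \<Rightarrow> ('a \<Rightarrow> 'k::{real_normed_field, euclidean_space})" where
  "dual_scale c f = (\<lambda>x. c * f x)"

definition dual_norm :: "'a::banach set \<Rightarrow> ('a \<Rightarrow> 'k::{real_normed_field, euclidean_space}) \<Rightarrow> real" where
  "dual_norm X f = (SUP x\<in>cball 0 1 \<inter> X. norm (f x))"

definition annihilator ::
    "('k::{real_normed_field, euclidean_space} \<Rightarrow> 'a::banach \<Rightarrow> 'a) \<Rightarrow> 'a set \<Rightarrow> 'a set \<Rightarrow> ('a \<Rightarrow> 'k) set" where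
  "annihilator smul X J = {f \<in> dual_space smul X. \<forall>x\<in>J. f x = 0}"

text \<open>The normed space is given by a carrier \<open>V\<close>, a scalar multiplication \<open>s\<close> and a norm \<open>N\<close>.\<close>

definition L_projection ::
    "'v::ab_group_add set \<Rightarrow> ('k \<Rightarrow> 'v \<Rightarrow> 'v) \<Rightarrow> ('v \<Rightarrow> real) \<Rightarrow> ('v \<Rightarrow> 'v) \<Rightarrow> bool" where
  "L_projection V s N P \<longleftrightarrow>
     P ` V \<subseteq> V \<and>
     (\<forall>u\<in>V. \<forall>v\<in>V. P (u + v) = P u + P v) \<and>
     (\<forall>c. \<forall>v\<in>V. P (s c v) = s c (P v)) \<and>
     (\<forall>v\<in>V. P (P v) = P v) \<and>
     (\<forall>v\<in>V. N v = N (P v) + N (v - P v))"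

definition associated_L_projection ::
    "('k::{real_normed_field, euclidean_space} \<Rightarrow> 'a::banach \<Rightarrow> 'a) \<Rightarrow> 'a set \<Rightarrow> 'a set
      \<Rightarrow> (('a \<Rightarrow> 'k) \<Rightarrow> ('a \<Rightarrow> 'k)) \<Rightarrow> bool" where
  "associated_L_projection smul X J Q \<longleftrightarrow>
     L_projection (dual_space smul X) dual_scale (dual_norm X) Q \<and>
     Q ` dual_space smul X = annihilator smul X J"

definition M_ideal ::
    "('k::{real_normed_field, euclidean_space} \<Rightarrow> 'a::banach \<Rightarrow> 'a) \<Rightarrow> 'a set \<Rightarrow> 'a set \<Rightarrow> bool" where
  "M_ideal smul X J \<longleftrightarrow>
     closed_subspace smul J \<and> J \<subseteq> X \<and> (\<exists>Q. associated_L_projection smul X J Q)"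

definition restr :: "'a set \<Rightarrow> ('a \<Rightarrow> 'k::zero) \<Rightarrow> ('a \<Rightarrow> 'k)" where
  "restr Y f = (\<lambda>x. if x \<in> Y then f x else 0)"

text \<open>
  An associated L-projection is uniquely determined on the dual space, so the existential
  quantifier over \<open>Q1\<close> and \<open>Q2\<close> just names them.
\<close>

definition simultaneous_M_ideal ::
    "('k::{real_normed_field, euclidean_space} \<Rightarrow> 'a::banach \<Rightarrow> 'a)
      \<Rightarrow> 'a set \<Rightarrow> 'a set \<Rightarrow> 'a set \<Rightarrow> 'a set \<Rightarrow> bool" where
  "simultaneous_M_ideal smul X1 X2 J1 J2 \<longleftrightarrow>
     M_ideal smul X1 J1 \<and> M_ideal smul X2 J2 \<and>
     (\<exists>Q1 Q2. associated_L_projection smul X1 J1 Q1 \<and>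
              associated_L_projection smul X2 J2 Q2 \<and>
              (\<forall>f\<in>dual_space smul X1. restr X2 (Q1 f) = Q2 (restr X2 f)))"

text \<open>
  The ball intersection conditions below are relative to the whole type as the space \<open>X1\<close>.  For
  \<open>n = 0\<close> the intersections are the whole space, and the conditions hold trivially.
\<close>

definition ball_condition :: "nat \<Rightarrow> 'a::banach set \<Rightarrow> 'a set \<Rightarrow> 'a set \<Rightarrow> bool" where
  "ball_condition n X2 J1 J2 \<longleftrightarrow>
     (\<forall>(x :: nat \<Rightarrow> 'a) (r :: nat \<Rightarrow> real).
        (\<forall>i\<in>{1..n}. r i > 0) \<longrightarrow>
        (\<forall>i\<in>{1..n}. cball (x i) (r i) \<inter> J1 \<noteq> {}) \<longrightarrow>
        (\<Inter>i\<in>{1..n}. cball (x i) (r i)) \<inter> X2 \<noteq> {} \<longrightarrow>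
        (\<forall>\<epsilon>>0. (\<Inter>i\<in>{1..n}. cball (x i) (r i + \<epsilon>)) \<inter> J2 \<noteq> {}))"

definition interior_ball_condition :: "nat \<Rightarrow> 'a::banach set \<Rightarrow> 'a set \<Rightarrow> 'a set \<Rightarrow> bool" where
  "interior_ball_condition n X2 J1 J2 \<longleftrightarrow>
     (\<forall>(x :: nat \<Rightarrow> 'a) (r :: nat \<Rightarrow> real).
        (\<forall>i\<in>{1..n}. r i > 0) \<longrightarrow>
        (\<forall>i\<in>{1..n}. cball (x i) (r i) \<inter> J1 \<noteq> {}) \<longrightarrow>
        interior (\<Inter>i\<in>{1..n}. cball (x i) (r i)) \<inter> X2 \<noteq> {} \<longrightarrow>
        (\<forall>\<epsilon>>0. (\<Inter>i\<in>{1..n}. cball (x i) (r i + \<epsilon>)) \<inter> J2 \<noteq> {}))"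

end

theory Submission
  imports Defs
begin

text \<open>
  The proof compares the ball conditions with the splitting of functionals by the L-projections.

  Suppose first that the projections commute with restriction to \<open>X2\<close>.  If the enlarged balls
  have no common point in \<open>J2\<close>, a separation argument in a power of the space yields
  functionals \<open>f i\<close> whose sum annihilates \<open>J2\<close> and which are too large at the centres
  (lemma \<open>separate_balls_from_subspace\<close>).  Commutation forces the complementary parts
  \<open>f i - Q1 (f i)\<close> to sum to 0 on \<open>X2\<close>.  So the parts \<open>Q1 (f i)\<close> can be evaluated
  relative to the points of \<open>J1\<close> in the balls, and the complementary parts relative to the
  common point in \<open>X2\<close>; additivity of the norm then contradicts separation
  (lemmas \<open>functional_sum_bound\<close> and \<open>balls_meet_of_commuting\<close>).

  Conversely, assume the condition on translates.  The key fact is that a functional \<open>f\<close> on the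
  whole space that annihilates \<open>J2\<close> coincides with \<open>Q1 f\<close> on \<open>X2\<close>.  The difference
  \<open>h = f - Q1 f\<close> lies in the kernel of \<open>Q1\<close>, so it attains its norm, up to any error, at
  some \<open>y\<close> in the unit ball of \<open>J1\<close>.  Because \<open>x + y\<close> is within \<open>1 + \<epsilon>\<close> of
  \<open>J2\<close>, where \<open>h\<close> vanishes, \<open>h x\<close> cannot have positive real part for any \<open>x\<close>
  in the unit ball of \<open>X2\<close> (lemma \<open>kernel_functional_vanishes\<close>).  In particular the
  restriction of \<open>Q1 f\<close> depends only on the restriction of \<open>f\<close>; this defines the
  projection \<open>Q2\<close>, which commutes with \<open>Q1\<close> by construction
  (lemma \<open>simultaneous_of_approximation\<close>).

  Both halves rest on the Hahn-Banach theorem, proved in one form that covers separation and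
  extension (lemma \<open>hahn_banach_sandwich\<close>), and on the passage between scalar-linear functionals
  and their real parts (lemma \<open>functional_of_real_part\<close>).
\<close>

section \<open>Hahn-Banach theorem over a convex cone\<close>

text \<open>
  The scalar multiplication is a parameter, since the theorem is applied both to a Banach space
  and to the space of sequences in it, which has pointwise operations but is no instance of the
  class of real vector spaces.  Positive homogeneity is stated as one inequality; the converse
  inequality follows by applying it to \<open>1 / t\<close>.
\<close>

definition sublinear :: "(real \<Rightarrow> 'v::ab_group_add \<Rightarrow> 'v) \<Rightarrow> ('v \<Rightarrow> real) \<Rightarrow> bool" where
  "sublinear sc p \<longleftrightarrow> (\<forall>x y. p (x + y) \<le> p x + p y) \<and> (\<forall>t\<ge>0. \<forall>x. p (sc t x) \<le> t * p x)"

lemma sublinear_zero: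
  assumes "vector_space sc" "sublinear sc p"
  shows "p 0 = 0"
proof -
  interpret vector_space sc by fact
  have "p (sc 0 0) \<le> 0 * p 0" "p (0 + 0) \<le> p 0 + p 0"
    using assms(2) unfolding sublinear_def by blast+
  then show ?thesis by simp
qed

lemma sublinear_minus:
  assumes "vector_space sc" "sublinear sc p"
  shows "- p (- x) \<le> p x"
proof -
  have "p (x + - x) \<le> p x + p (- x)"
    using assms(2) unfolding sublinear_def by blast
  then show ?thesis using sublinear_zero[OF assms] by simp
qed

text \<open>
  The cone \<open>G\<close> is the hypograph of the prescribed lower bounds: \<open>(k, s) \<in> G\<close> demands that
  the functional to be found is at least \<open>s\<close> at \<open>k\<close>.  The infimal convolution
  \<open>q x = (INF (k, s)\<in>G. p (x + k) - s)\<close> turns these demands into upper bounds at the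
  points \<open>- k\<close>, so that any linear functional below \<open>q\<close> meets them.
\<close>

lemma sublinear_lower_over_cone:
  assumes vs: "vector_space sc" and p: "sublinear sc p"
    and G0: "(0, 0) \<in> G"
    and Gadd: "\<And>k s l t. (k, s) \<in> G \<Longrightarrow> (l, t) \<in> G \<Longrightarrow> (k + l, s + t) \<in> G"
    and Gscale: "\<And>k s c. (k, s) \<in> G \<Longrightarrow> c \<ge> 0 \<Longrightarrow> (sc c k, c * s) \<in> G"
    and Gp: "\<And>k s. (k, s) \<in> G \<Longrightarrow> s \<le> p k"
  shows "\<exists>q. sublinear sc q \<and> (\<forall>x. q x \<le> p x) \<and> (\<forall>(k, s)\<in>G. q (- k) \<le> - s)"
proof -
  interpret vector_space sc by fact
  have padd: "p (x + y) \<le> p x + p y" for x y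
    using p unfolding sublinear_def by blast
  have pscale: "t \<ge> 0 \<Longrightarrow> p (sc t x) \<le> t * p x" for t x
    using p unfolding sublinear_def by blast
  define q where "q x = (INF (k, s)\<in>G. p (x + k) - s)" for x
  have low: "- p (- x) \<le> p (x + k) - s" if "(k, s) \<in> G" for x k s
    using padd[of "x + k" "- x"] Gp[OF that] by simp
  have bdd: "bdd_below ((\<lambda>(k, s). p (x + k) - s) ` G)" for x
    by (rule bdd_belowI2[of _ "- p (- x)"]) (use low in auto)
  have upper: "q x \<le> p (x + k) - s" if "(k, s) \<in> G" for x k s
    unfolding q_def using cINF_lower[OF bdd that, of x] by simp
  have greatest: "m \<le> q x" if "\<And>k s. (k, s) \<in> G \<Longrightarrow> m \<le> p (x + k) - s" for m x
    unfolding q_def by (rule cINF_greatest) (use G0 that in auto)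
  have "sublinear sc q"
    unfolding sublinear_def
  proof (intro conjI allI impI)
    fix x y
    have "q (x + y) - (p (y + l) - t) \<le> q x" if l: "(l, t) \<in> G" for l t
    proof (rule greatest)
      fix k s assume k: "(k, s) \<in> G"
      have "q (x + y) \<le> p ((x + k) + (y + l)) - (s + t)"
        using upper[OF Gadd[OF k l], of "x + y"] by (simp add: algebra_simps)
      then show "q (x + y) - (p (y + l) - t) \<le> p (x + k) - s"
        using padd[of "x + k" "y + l"] by simp
    qed
    then have "q (x + y) - q x \<le> p (y + l) - t" if "(l, t) \<in> G" for l t
      using that by (smt (verit))
    then have "q (x + y) - q x \<le> q y" by (rule greatest)
    then show "q (x + y) \<le> q x + q y" by simp
  next
    fix t :: real and x assume t: "t \<ge> 0"
    have *: "q (sc t x) \<le> t * (p (x + k) - s)" if "(k, s) \<in> G" for k s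
      using upper[OF Gscale[OF that t], of "sc t x"] pscale[OF t, of "x + k"]
      by (simp add: algebra_simps)
    show "q (sc t x) \<le> t * q x"
    proof (cases "t = 0")
      case True
      then show ?thesis using *[OF G0] by simp
    next
      case False
      then have "q (sc t x) / t \<le> q x"
        using t by (intro greatest) (auto simp: divide_simps mult.commute dest!: *)
      then show ?thesis using t False by (simp add: divide_simps mult.commute)
    qed
  qed
  moreover have "q x \<le> p x" for x using upper[OF G0, of x] by simp
  moreover have "q (- k) \<le> - s" if "(k, s) \<in> G" for k s
    using upper[OF that, of "- k"] sublinear_zero[OF vs p] by simp
  ultimately show ?thesis by (intro exI[of _ q]) auto
qed

text \<open>
  A sublinear functional that is minimal below \<open>p\<close> is already linear: lowering it over the ray
  through \<open>y\<close> must leave it unchanged, which forces it to be odd at \<open>y\<close>, and an odd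
  subadditive functional is additive.  Minimal ones exist by Zorn's lemma, because the pointwise
  infimum of a chain is again sublinear.
\<close>

lemma linear_minorant_exists:
  fixes sc :: "real \<Rightarrow> 'v::ab_group_add \<Rightarrow> 'v" and p :: "'v \<Rightarrow> real"
  assumes vs: "vector_space sc" and p: "sublinear sc p"
  shows "\<exists>f. (\<forall>x y. f (x + y) = f x + f y) \<and> (\<forall>t x. f (sc t x) = t * f x) \<and> (\<forall>x. f x \<le> p x)"
proof -
  interpret vector_space sc by fact
  define A where "A = {q. sublinear sc q \<and> (\<forall>x. q x \<le> p x)}"
  define P where "P q q' \<longleftrightarrow> (\<forall>x. q' x \<le> q x)" for q q' :: "'v \<Rightarrow> real"
  have Aadd: "q (x + y) \<le> q x + q y" and Ascale: "t \<ge> 0 \<Longrightarrow> q (sc t x) \<le> t * q x"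
    and Ap: "q x \<le> p x" if "q \<in> A" for q x y t
    using that unfolding A_def sublinear_def by auto
  have "\<exists>m\<in>A. \<forall>a\<in>A. P m a \<longrightarrow> a = m"
  proof (rule predicate_Zorn)
    show "partial_order_on A (relation_of P A)"
      by (rule partial_order_on_relation_ofI) (auto simp: P_def fun_eq_iff intro: order.trans order.antisym)
    fix C assume C: "C \<in> Chains (relation_of P A)"
    have CA: "C \<subseteq> A" and tot: "q \<in> C \<Longrightarrow> q' \<in> C \<Longrightarrow> P q q' \<or> P q' q" for q q'
      using C unfolding Chains_def relation_of_def by auto
    show "\<exists>u\<in>A. \<forall>a\<in>C. P a u"
    proof (cases "C = {}")
      case True
      then show ?thesis using p by (auto simp: A_def)
    next
      case False
      define u where "u x = (INF q\<in>C. q x)" for x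
      have bdd: "bdd_below ((\<lambda>q. q x) ` C)" for x
      proof (rule bdd_belowI2[of _ "- p (- x)"])
        fix q assume "q \<in> C"
        then have "q \<in> A" using CA by auto
        then show "- p (- x) \<le> q x"
          using sublinear_minus[OF vs, of q x] Ap[OF \<open>q \<in> A\<close>, of "- x"] unfolding A_def
          by (smt (verit) mem_Collect_eq)
      qed
      have upper: "u x \<le> q x" if "q \<in> C" for q x
        unfolding u_def by (rule cINF_lower[OF bdd that])
      have greatest: "m \<le> u x" if "\<And>q. q \<in> C \<Longrightarrow> m \<le> q x" for m x
        unfolding u_def by (rule cINF_greatest[OF False that])
      have "sublinear sc u"
        unfolding sublinear_def
      proof (intro conjI allI impI)
        fix x y
        have *: "u (x + y) \<le> q x + q' y" if q: "q \<in> C" "q' \<in> C" for q q'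
        proof (cases "P q q'")
          case True
          then show ?thesis
            using upper[OF q(2), of "x + y"] Aadd[of q' x y] q CA unfolding P_def
            by (smt (verit) subset_iff)
        next
          case False
          then show ?thesis
            using tot[OF q] upper[OF q(1), of "x + y"] Aadd[of q x y] q CA unfolding P_def
            by (smt (verit) subset_iff)
        qed
        have "u (x + y) - q' y \<le> u x" if "q' \<in> C" for q'
          by (rule greatest) (use *[OF _ that] in fastforce)
        then have "u (x + y) - u x \<le> u y" by (intro greatest) fastforce
        then show "u (x + y) \<le> u x + u y" by simp
      next
        fix t :: real and x assume t: "t \<ge> 0"
        have *: "u (sc t x) \<le> t * q x" if "q \<in> C" for q
          using upper[OF that, of "sc t x"] Ascale[of q t x] t that CA by fastforce
        show "u (sc t x) \<le> t * u x"
        proof (cases "t = 0")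
          case True
          then show ?thesis using * \<open>C \<noteq> {}\<close> by auto
        next
          case False
          then have "u (sc t x) / t \<le> u x"
            using t by (intro greatest) (auto simp: divide_simps mult.commute dest!: *)
          then show ?thesis using t False by (simp add: divide_simps mult.commute)
        qed
      qed
      moreover have "u x \<le> p x" for x
        using False upper Ap CA by (meson ex_in_conv order.trans subsetD)
      ultimately show ?thesis using upper by (auto simp: A_def P_def intro!: bexI[of _ u])
    qed
  qed
  then obtain f where fA: "f \<in> A" and min: "\<And>q. q \<in> A \<Longrightarrow> P f q \<Longrightarrow> q = f" by blast
  have f: "sublinear sc f" using fA by (simp add: A_def)
  have odd: "f (- y) = - f y" for y
  proof -
    let ?G = "{(sc t y, t * f y) | t. t \<ge> 0}"
    have "\<exists>q. sublinear sc q \<and> (\<forall>x. q x \<le> f x) \<and> (\<forall>(k, s)\<in>?G. q (- k) \<le> - s)"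
    proof (rule sublinear_lower_over_cone[OF vs f, of ?G])
      show "(0, 0) \<in> ?G" by (auto intro!: exI[of _ 0])
      show "(k + l, s + t) \<in> ?G" if "(k, s) \<in> ?G" "(l, t) \<in> ?G" for k s l t
        using that by (force simp: scale_left_distrib[symmetric] distrib_right[symmetric])
      show "(sc c k, c * s) \<in> ?G" if "(k, s) \<in> ?G" "c \<ge> 0" for k s c
        using that by (force simp: mult.assoc[symmetric])
      show "s \<le> f k" if ks: "(k, s) \<in> ?G" for k s
      proof -
        obtain t where t: "t \<ge> 0" "k = sc t y" "s = t * f y" using ks by auto
        show ?thesis
        proof (cases "t = 0")
          case True then show ?thesis using t sublinear_zero[OF vs f] by simp
        next
          case False
          then have "f (sc (1 / t) k) \<le> (1 / t) * f k"
            using t by (intro Ascale[OF fA]) auto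
          then show ?thesis using t False by (simp add: divide_simps mult.commute)
        qed
      qed
    qed
    then obtain q where q: "sublinear sc q" "\<forall>x. q x \<le> f x" "\<forall>(k, s)\<in>?G. q (- k) \<le> - s"
      by (elim exE conjE)
    have "q \<in> A" using q(1) order.trans[OF q(2)[rule_format] Ap[OF fA]] by (simp add: A_def)
    then have "q = f" using q(2) by (intro min) (auto simp: P_def)
    moreover have "(y, f y) \<in> ?G" by (auto intro!: exI[of _ 1])
    ultimately have "f (- y) \<le> - f y" using q(3) by fast
    then show ?thesis using sublinear_minus[OF vs f, of y] by simp
  qed
  have scale: "f (sc t x) = t * f x" if "t \<ge> 0" for t x
    using Ascale[OF fA that, of x] Ascale[OF fA that, of "- x"] odd[of x] odd[of "sc t x"] by simp
  have "f (x + y) = f x + f y" for x y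
    using Aadd[OF fA, of x y] Aadd[OF fA, of "- x" "- y"] odd[of x] odd[of y] odd[of "x + y"]
    by simp
  moreover have "f (sc t x) = t * f x" for t x
    using scale[of t x] scale[of "- t" x] odd[of "sc t x"] by (cases "t \<ge> 0") auto
  ultimately show ?thesis using Ap[OF fA] by (intro exI[of _ f] conjI allI)
qed

text \<open>
  Stated for hypographs, the theorem gives the extension of a functional from a subspace (\<open>G\<close>
  is its graph) and the separation of a point from a subspace (\<open>G\<close> is a cone over the affine
  subspace through that point) as special cases.
\<close>

lemma hahn_banach_sandwich:
  assumes vs: "vector_space sc" and p: "sublinear sc p"
    and "(0, 0) \<in> G"
    and "\<And>k s l t. (k, s) \<in> G \<Longrightarrow> (l, t) \<in> G \<Longrightarrow> (k + l, s + t) \<in> G"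
    and "\<And>k s c. (k, s) \<in> G \<Longrightarrow> c \<ge> 0 \<Longrightarrow> (sc c k, c * s) \<in> G"
    and "\<And>k s. (k, s) \<in> G \<Longrightarrow> s \<le> p k"
  shows "\<exists>f. (\<forall>x y. f (x + y) = f x + f y) \<and> (\<forall>t x. f (sc t x) = t * f x) \<and>
    (\<forall>x. f x \<le> p x) \<and> (\<forall>(k, s)\<in>G. s \<le> f k)"
proof -
  interpret vector_space sc by fact
  have "\<exists>q. sublinear sc q \<and> (\<forall>x. q x \<le> p x) \<and> (\<forall>(k, s)\<in>G. q (- k) \<le> - s)"
    by (rule sublinear_lower_over_cone[OF assms])
  then obtain q where q: "sublinear sc q" "\<forall>x. q x \<le> p x" "\<forall>(k, s)\<in>G. q (- k) \<le> - s"
    by (elim exE conjE)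
  obtain f where f: "\<forall>x y. f (x + y) = f x + f y" "\<forall>t x. f (sc t x) = t * f x" "\<forall>x. f x \<le> q x"
    using linear_minorant_exists[OF vs q(1)] by (elim exE conjE)
  have "s \<le> f k" if "(k, s) \<in> G" for k s
  proof -
    have "f (- k) = - f k" using f(2)[rule_format, of "-1" k] by simp
    then show ?thesis using f(3)[rule_format, of "- k"] bspec[OF q(3) that] by simp
  qed
  moreover have "f x \<le> p x" for x using f(3) q(2) order.trans by blast
  ultimately show ?thesis using f(1,2) by (intro exI[of _ f] conjI ballI) auto
qed

section \<open>Scalars and their real parts\<close>

text \<open>
  The map \<open>inner 1\<close> is the real part.  Everything about it that is needed below comes from the
  fact that the bilinear form \<open>inner 1 (c * z)\<close> is nondegenerate, since nonzero scalars are
  invertible.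
\<close>

lemma scalar_eqI:
  fixes z w :: "'k::{real_normed_field, euclidean_space}"
  assumes "\<And>c. inner 1 (c * z) = inner 1 (c * w)"
  shows "z = w"
proof (rule ccontr)
  assume "z \<noteq> w"
  then have "inner 1 (inverse (z - w) * (z - w)) = inner (1::'k) 1" by simp
  also have "\<dots> = 1" by (simp add: dot_square_norm)
  also have "inner 1 (inverse (z - w) * (z - w)) = 0"
    using assms[of "inverse (z - w)"] by (simp add: right_diff_distrib inner_diff_right)
  finally show False by simp
qed

lemma inner_one_le_norm: "inner 1 z \<le> norm (z :: 'k::{real_normed_field, euclidean_space})"
  using norm_cauchy_schwarz[of 1 z] by simp

lemma scalar_rotate_to_norm:
  fixes z :: "'k::{real_normed_field, euclidean_space}"
  obtains c where "norm c = 1" "inner 1 (c * z) = norm z"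
proof (cases "z = 0")
  case True
  then show thesis using that[of 1] by simp
next
  case False
  have "of_real (norm z) / z * z = norm z *\<^sub>R (1::'k)"
    using False unfolding of_real_def[symmetric] by simp
  then have "inner 1 (of_real (norm z) / z * z) = inner 1 (norm z *\<^sub>R (1::'k))"
    by simp
  also have "\<dots> = norm z" by (simp add: dot_square_norm)
  finally show thesis
    using that[of "of_real (norm z) / z"] False by (simp add: norm_divide)
qed

text \<open>
  Nondegeneracy says that the linear map taking \<open>z\<close> to the functional
  \<open>\<lambda>c. inner 1 (c * z)\<close>, here in coordinates, is injective; it is onto by counting
  dimensions.
\<close>

lemma scalar_functional_representation:
  fixes L :: "'k::{real_normed_field, euclidean_space} \<Rightarrow> real"
  assumes L: "linear L"
  shows "\<exists>z. \<forall>c. inner 1 (c * z) = L c"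
proof -
  define T where "T z = (\<Sum>b\<in>Basis. inner 1 (b * z) *\<^sub>R b)" for z :: 'k
  have lin1: "linear (\<lambda>c. inner 1 (c * z))" for z :: 'k
    by (rule linearI) (simp_all add: distrib_right inner_add_right)
  have T: "inner (T z) b = inner 1 (b * z)" if "b \<in> Basis" for z b :: 'k
    using that by (simp add: T_def)
  have linT: "linear T"
    by (rule linearI)
      (simp_all add: T_def distrib_left inner_add_right scaleR_add_left sum.distrib scaleR_sum_right)
  have "inj T"
  proof (subst linear_injective_0[OF linT], intro allI impI)
    fix z assume "T z = 0"
    then have "inner 1 (b * z) = 0" if "b \<in> Basis" for b
      using T[OF that, of z] by simp
    then have "(\<lambda>c. inner 1 (c * z)) = (\<lambda>c. 0)"
      by (intro linear_eq_stdbasis[OF lin1]) (auto intro: linear_zero)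
    then have "inner 1 (c * z) = 0" for c by (rule fun_cong)
    then show "z = 0" by (rule scalar_eqI[of z 0, simplified])
  qed
  then have "surj T" by (rule linear_injective_imp_surjective[OF linT _ refl])
  then obtain z where z: "T z = (\<Sum>b\<in>Basis. L b *\<^sub>R b)"
    by (rule surjE[of T "\<Sum>b\<in>Basis. L b *\<^sub>R b"]) simp
  have "inner 1 (b * z) = L b" if "b \<in> Basis" for b
    using T[OF that, of z] that by (simp add: z)
  then have "(\<lambda>c. inner 1 (c * z)) = L"
    by (intro linear_eq_stdbasis[OF lin1 L])
  then show ?thesis by (intro exI[of _ z] allI) (rule fun_cong)
qed

section \<open>Dual spaces, dual norms and norm-preserving extension\<close>

lemma restr_agree_iff: "restr Y f = restr Y g \<longleftrightarrow> (\<forall>x\<in>Y. f x = g x)"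
  by (auto simp: restr_def fun_eq_iff)

context banach_over
begin

lemma dual_spaceD:
  assumes "f \<in> dual_space smul X"
  shows "\<And>x y. x \<in> X \<Longrightarrow> y \<in> X \<Longrightarrow> f (x + y) = f x + f y"
    and "\<And>c x. x \<in> X \<Longrightarrow> f (smul c x) = c * f x"
    and "\<And>x. x \<notin> X \<Longrightarrow> f x = 0"
    and "\<exists>B. \<forall>x\<in>X. norm (f x) \<le> B * norm x"
  using assms unfolding dual_space_def by auto

lemma dual_scaleR:
  assumes "f \<in> dual_space smul X" "x \<in> X"
  shows "f (t *\<^sub>R x) = t *\<^sub>R f x"
  using dual_spaceD(2)[OF assms, of "of_real t"] by (simp add: scale_of_real scaleR_conv_of_real)

lemma dual_diff_arg:
  assumes "f \<in> dual_space smul UNIV"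
  shows "f (x - y) = f x - f y"
  using dual_spaceD(1)[OF assms, of "x - y" y] by simp

lemma dual_add:
  assumes f: "f \<in> dual_space smul X" and g: "g \<in> dual_space smul X"
  shows "f + g \<in> dual_space smul X"
proof -
  obtain A B where "\<forall>x\<in>X. norm (f x) \<le> A * norm x" "\<forall>x\<in>X. norm (g x) \<le> B * norm x"
    using dual_spaceD(4)[OF f] dual_spaceD(4)[OF g] by blast
  then have "\<forall>x\<in>X. norm (f x + g x) \<le> (A + B) * norm x"
    by (metis add_mono distrib_right norm_triangle_le)
  then show ?thesis
    using dual_spaceD(1-3)[OF f] dual_spaceD(1-3)[OF g]
    by (auto simp: dual_space_def distrib_left)
qed

lemma dual_dual_scale:
  assumes f: "f \<in> dual_space smul X"
  shows "dual_scale c f \<in> dual_space smul X"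
proof -
  obtain A where "\<forall>x\<in>X. norm (f x) \<le> A * norm x"
    using dual_spaceD(4)[OF f] by blast
  then have "\<forall>x\<in>X. norm (c * f x) \<le> (norm c * A) * norm x"
    by (simp add: norm_mult mult.assoc mult_left_mono)
  then show ?thesis
    using dual_spaceD(1-3)[OF f] by (auto simp: dual_space_def dual_scale_def distrib_left)
qed

lemma dual_diff:
  assumes f: "f \<in> dual_space smul X" and g: "g \<in> dual_space smul X"
  shows "f - g \<in> dual_space smul X"
proof -
  have "f - g = f + dual_scale (- 1) g" by (auto simp: dual_scale_def)
  then show ?thesis by (simp only: dual_add[OF f dual_dual_scale[OF g]])
qed

lemma dual_zero: "(\<lambda>x. 0) \<in> dual_space smul X"
  by (auto simp: dual_space_def intro: exI[of _ 0])

lemma dual_restr: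
  assumes f: "f \<in> dual_space smul UNIV" and X: "module.subspace smul X"
  shows "restr X f \<in> dual_space smul X"
  using f X subspace_add[OF X] subspace_scale[OF X] unfolding dual_space_def restr_def by auto

lemma dual_norm_bdd:
  assumes f: "f \<in> dual_space smul X"
  shows "bdd_above ((\<lambda>x. norm (f x)) ` (cball 0 1 \<inter> X))"
proof -
  obtain B where B: "\<And>x. x \<in> X \<Longrightarrow> norm (f x) \<le> B * norm x"
    using dual_spaceD(4)[OF f] by blast
  show ?thesis
  proof (rule bdd_aboveI2)
    fix x assume x: "x \<in> cball 0 1 \<inter> X"
    have "B * norm x \<le> \<bar>B\<bar> * 1" using x by (intro mult_mono) auto
    then show "norm (f x) \<le> \<bar>B\<bar>" using B[of x] x by simp
  qed
qed

lemma norm_le_dual_norm: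
  assumes f: "f \<in> dual_space smul X" and X: "module.subspace smul X" and x: "x \<in> X"
  shows "norm (f x) \<le> dual_norm X f * norm x"
proof (cases "x = 0")
  case True
  then show ?thesis using dual_spaceD(2)[OF f x, of 0] by simp
next
  case False
  let ?y = "(1 / norm x) *\<^sub>R x"
  have "?y \<in> X" using subspace_scale[OF X x, of "of_real (1 / norm x)"] by (simp only: scale_of_real)
  then have "norm (f ?y) \<le> dual_norm X f"
    unfolding dual_norm_def using False by (intro cSUP_upper[OF _ dual_norm_bdd[OF f]]) auto
  then show ?thesis using False by (simp add: dual_scaleR[OF f x] divide_simps)
qed

lemma dual_norm_least:
  assumes X: "module.subspace smul X" and "C \<ge> 0" "\<And>x. x \<in> X \<Longrightarrow> norm (f x) \<le> C * norm x"
  shows "dual_norm X f \<le> C"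
  unfolding dual_norm_def
proof (rule cSUP_least)
  have "0 \<in> cball 0 1 \<inter> X" using subspace_0[OF X] by simp
  then show "cball 0 1 \<inter> X \<noteq> {}" by blast
  fix x assume x: "x \<in> cball 0 1 \<inter> X"
  have "C * norm x \<le> C * 1" using x assms(2) by (intro mult_left_mono) auto
  then show "norm (f x) \<le> C" using assms(3)[of x] x by simp
qed

lemma dual_norm_nonneg:
  assumes f: "f \<in> dual_space smul X" and X: "module.subspace smul X"
  shows "0 \<le> dual_norm X f"
proof -
  have "norm (f 0) \<le> dual_norm X f"
    unfolding dual_norm_def using subspace_0[OF X] by (intro cSUP_upper[OF _ dual_norm_bdd[OF f]]) auto
  then show ?thesis using norm_ge_zero by (rule order.trans[rotated])
qed

lemma dual_norm_triangle:
  assumes f: "f \<in> dual_space smul X" and g: "g \<in> dual_space smul X" and X: "module.subspace smul X"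
  shows "dual_norm X (f + g) \<le> dual_norm X f + dual_norm X g"
proof (rule dual_norm_least[OF X])
  fix x assume x: "x \<in> X"
  show "norm ((f + g) x) \<le> (dual_norm X f + dual_norm X g) * norm x"
    using norm_le_dual_norm[OF f X x] norm_le_dual_norm[OF g X x] norm_triangle_ineq[of "f x" "g x"]
    by (simp add: distrib_right)
qed (use dual_norm_nonneg[OF f X] dual_norm_nonneg[OF g X] in simp)

lemma dual_norm_restr_le:
  assumes f: "f \<in> dual_space smul UNIV" and X: "module.subspace smul X"
  shows "dual_norm X (restr X f) \<le> dual_norm UNIV f"
proof (rule dual_norm_least[OF X])
  show "norm (restr X f x) \<le> dual_norm UNIV f * norm x" if "x \<in> X" for x
    using norm_le_dual_norm[OF f subspace_UNIV, of x] that by (simp add: restr_def)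
qed (rule dual_norm_nonneg[OF f subspace_UNIV])

text \<open>
  The supremum may be taken over real parts, because a point of the unit ball may be multiplied by
  a scalar of norm 1.
\<close>

lemma dual_norm_attained_up_to:
  assumes f: "f \<in> dual_space smul X" and X: "module.subspace smul X" and "c < dual_norm X f"
  obtains x where "x \<in> X" "norm x \<le> 1" "c < inner 1 (f x)"
proof -
  have "0 \<in> cball 0 1 \<inter> X" using subspace_0[OF X] by simp
  then have "\<exists>x\<in>cball 0 1 \<inter> X. c < norm (f x)"
    using assms(3) less_cSUP_iff[OF _ dual_norm_bdd[OF f]] unfolding dual_norm_def by blast
  then obtain x where x: "x \<in> X" "norm x \<le> 1" "c < norm (f x)" by auto
  obtain a where a: "norm a = 1" "inner 1 (a * f x) = norm (f x)"
    by (rule scalar_rotate_to_norm)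
  show thesis
    using that[of "smul a x"] x a subspace_scale[OF X x(1), of a] dual_spaceD(2)[OF f x(1), of a]
    by (simp add: norm_scale)
qed

text \<open>
  A real-linear functional is the real part of exactly one scalar-linear functional: its value at
  \<open>x\<close> represents \<open>\<lambda>c. u (smul c x)\<close>.  The bound carries over by rotating the value
  onto its norm.
\<close>

lemma functional_of_real_part:
  assumes add: "\<And>x y. u (x + y) = u x + u y" and scale: "\<And>t x. u (t *\<^sub>R x) = t * u x"
    and bound: "\<And>x. u x \<le> C * norm x"
  shows "\<exists>f\<in>dual_space smul UNIV. (\<forall>x. inner 1 (f x) = u x) \<and> (\<forall>x. norm (f x) \<le> C * norm x)"
proof -
  have "linear (\<lambda>c. u (smul c x))" for x
  proof (rule linearI)
    show "u (smul (b + c) x) = u (smul b x) + u (smul c x)" for b c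
      by (simp add: scale_left_distrib add)
    have "smul (t *\<^sub>R c) x = t *\<^sub>R smul c x" for t c
      using scale_scale[of "of_real t" c x] by (simp only: scale_of_real scaleR_conv_of_real[of t c])
    then show "u (smul (t *\<^sub>R c) x) = t *\<^sub>R u (smul c x)" for t c
      by (simp add: scale)
  qed
  then have "\<exists>z. \<forall>c. inner 1 (c * z) = u (smul c x)" for x
    by (rule scalar_functional_representation)
  then obtain f where f: "\<And>x c. inner 1 (c * f x) = u (smul c x)" by metis
  have fadd: "f (x + y) = f x + f y" for x y
    by (rule scalar_eqI) (simp add: f distrib_left inner_add_right scale_right_distrib add)
  have fscale: "f (smul d x) = d * f x" for d x
    by (rule scalar_eqI) (simp add: f mult.assoc[symmetric])
  have norm: "norm (f x) \<le> C * norm x" for x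
  proof -
    obtain c where c: "norm c = 1" "inner 1 (c * f x) = norm (f x)"
      by (rule scalar_rotate_to_norm)
    then show ?thesis using bound[of "smul c x"] f[of c x] by (simp add: norm_scale)
  qed
  have "f \<in> dual_space smul UNIV" using fadd fscale norm by (auto simp: dual_space_def)
  moreover have "inner 1 (f x) = u x" for x using f[of 1 x] by simp
  ultimately show ?thesis using norm by (intro bexI[of _ f]) auto
qed

text \<open>
  The real part of \<open>g\<close> is extended as a real functional and then made scalar-linear.  The
  result agrees with \<open>g\<close> itself on \<open>M\<close>, not only in its real part, because \<open>M\<close> is
  closed under the scalars.
\<close>

lemma hahn_banach_extension:
  assumes M: "module.subspace smul M" and g: "g \<in> dual_space smul M"
  shows "\<exists>f\<in>dual_space smul UNIV. (\<forall>x\<in>M. f x = g x) \<and> dual_norm UNIV f \<le> dual_norm M g"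
proof -
  let ?C = "dual_norm M g"
  have C: "?C \<ge> 0" by (rule dual_norm_nonneg[OF g M])
  have vs: "vector_space ((*\<^sub>R) :: real \<Rightarrow> 'a \<Rightarrow> 'a)" by (rule real_vector.vector_space_axioms)
  define G where "G = (\<lambda>m. (m, inner 1 (g m))) ` M"
  have G_mem: "(k, s) \<in> G \<longleftrightarrow> k \<in> M \<and> s = inner 1 (g k)" for k s
    unfolding G_def by blast
  have Mscale: "t *\<^sub>R m \<in> M" if "m \<in> M" for t m
    using subspace_scale[OF M that, of "of_real t"] by (simp only: scale_of_real)
  have sub: "sublinear (*\<^sub>R) (\<lambda>x::'a. ?C * norm x)"
    unfolding sublinear_def
  proof (intro conjI allI impI)
    show "?C * norm (x + y) \<le> ?C * norm x + ?C * norm y" for x y :: 'a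
      unfolding distrib_left[symmetric] by (rule mult_left_mono[OF norm_triangle_ineq C])
  qed simp
  have G0: "(0, 0) \<in> G"
    using subspace_0[OF M] dual_spaceD(2)[OF g, of 0 0] by (auto simp: G_mem)
  have Gadd: "(k + l, s + t) \<in> G" if "(k, s) \<in> G" "(l, t) \<in> G" for k s l t
    using that subspace_add[OF M] dual_spaceD(1)[OF g] by (simp add: G_mem inner_add_right)
  have Gscale: "(c *\<^sub>R k, c * s) \<in> G" if "(k, s) \<in> G" for k s c
    using that Mscale dual_scaleR[OF g] by (simp add: G_mem)
  have Gle: "s \<le> ?C * norm k" if "(k, s) \<in> G" for k s
  proof -
    have "k \<in> M" "s = inner 1 (g k)" using that by (auto simp: G_mem)
    then show ?thesis using norm_le_dual_norm[OF g M, of k] inner_one_le_norm[of "g k"] by simp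
  qed
  have "\<exists>u. (\<forall>x y. u (x + y) = u x + u y) \<and> (\<forall>t x. u (t *\<^sub>R x) = t * u x) \<and>
      (\<forall>x. u x \<le> ?C * norm x) \<and> (\<forall>(k, s)\<in>G. s \<le> u k)"
    by (rule hahn_banach_sandwich[OF vs sub G0 Gadd Gscale Gle])
  then obtain u where u: "\<forall>x y. u (x + y) = u x + u y" "\<forall>t x. u (t *\<^sub>R x) = t * u x"
    "\<forall>x. u x \<le> ?C * norm x" "\<forall>(k, s)\<in>G. s \<le> u k"
    by (elim exE conjE)
  have ge: "inner 1 (g m) \<le> u m" if "m \<in> M" for m
    using that bspec[OF u(4), of "(m, inner 1 (g m))"] by (simp add: G_mem)
  have eq: "u m = inner 1 (g m)" if m: "m \<in> M" for m
    using ge[OF m] ge[OF Mscale[OF m, of "-1"]] dual_scaleR[OF g m, of "-1"] u(2)[rule_format, of "-1" m]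
    by simp
  have "\<exists>f\<in>dual_space smul UNIV. (\<forall>x. inner 1 (f x) = u x) \<and> (\<forall>x. norm (f x) \<le> ?C * norm x)"
    by (rule functional_of_real_part[of u ?C, OF u(1-3)[rule_format]])
  then obtain f where f: "f \<in> dual_space smul UNIV" "\<forall>x. inner 1 (f x) = u x"
      "\<forall>x. norm (f x) \<le> ?C * norm x" by (elim bexE conjE)
  have "f m = g m" if m: "m \<in> M" for m
  proof (rule scalar_eqI)
    fix c
    have "inner 1 (f (smul c m)) = inner 1 (g (smul c m))"
      using f(2)[rule_format] eq[OF subspace_scale[OF M m]] by simp
    then show "inner 1 (c * f m) = inner 1 (c * g m)"
      using dual_spaceD(2)[OF f(1)] dual_spaceD(2)[OF g m] by simp
  qed
  moreover have "dual_norm UNIV f \<le> dual_norm M g"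
    by (rule dual_norm_least[OF subspace_UNIV C f(3)[rule_format]])
  ultimately show ?thesis using f(1) by (intro bexI[of _ f]) auto
qed

end

section \<open>Separating balls from a subspace\<close>

text \<open>
  A common point of the balls in \<open>D\<close> is a point of the diagonal copy of \<open>D\<close> in the
  product space that lies in the product of the balls.  If there is none, the centre \<open>x\<close> has
  distance at least 1 from the diagonal for the gauge \<open>p F = Max (norm (F i) / R i)\<close>, and a
  functional separates the two.  Its coordinates are the \<open>f i\<close>.  The value 0 is inserted into
  the maximum so that the empty index set is no exception.
\<close>

lemma separate_balls_from_subspace:
  fixes x :: "nat \<Rightarrow> 'a::real_normed_vector" and R :: "nat \<Rightarrow> real"
  assumes I: "finite I" and R: "\<And>i. i \<in> I \<Longrightarrow> R i > 0" and D: "subspace D"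
    and disjoint: "\<And>z. z \<in> D \<Longrightarrow> \<exists>i\<in>I. norm (x i - z) > R i"
  shows "\<exists>f :: nat \<Rightarrow> 'a \<Rightarrow> real. (\<forall>i. linear (f i)) \<and> (\<forall>z\<in>D. (\<Sum>i\<in>I. f i z) = 0) \<and> 1 \<le> (\<Sum>i\<in>I. f i (x i)) \<and>
    (\<forall>u. (\<forall>i\<in>I. norm (u i) \<le> R i) \<longrightarrow> (\<Sum>i\<in>I. f i (u i)) \<le> 1)"
proof -
  define sc :: "real \<Rightarrow> (nat \<Rightarrow> 'a) \<Rightarrow> (nat \<Rightarrow> 'a)" where "sc t F = (\<lambda>i. t *\<^sub>R F i)" for t F
  define p where "p F = Max (insert 0 ((\<lambda>i. norm (F i) / R i) ` I))" for F :: "nat \<Rightarrow> 'a"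
  define G where "G = {(\<lambda>i. t *\<^sub>R x i - d, t) | t d. t \<ge> 0 \<and> d \<in> D}"
  have vs: "vector_space sc"
    by unfold_locales (auto simp: sc_def fun_eq_iff algebra_simps)
  have p_le_iff: "p F \<le> c \<longleftrightarrow> 0 \<le> c \<and> (\<forall>i\<in>I. norm (F i) \<le> c * R i)" for F c
    unfolding p_def using I R by (subst Max_le_iff) (auto simp: pos_divide_le_eq)
  have p_nonneg: "0 \<le> p F" and p_bound: "i \<in> I \<Longrightarrow> norm (F i) \<le> p F * R i" for F i
    using p_le_iff[of F "p F"] by auto
  have sub: "sublinear sc p"
    unfolding sublinear_def
  proof (intro conjI allI impI)
    show "p (F + F') \<le> p F + p F'" for F F'
      unfolding p_le_iff using p_nonneg p_bound
      by (auto simp: distrib_right intro!: norm_triangle_mono add_nonneg_nonneg)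
    show "p (sc t F) \<le> t * p F" if "t \<ge> 0" for t F
      unfolding p_le_iff using p_nonneg p_bound that
      by (auto simp: sc_def mult.assoc intro!: mult_left_mono mult_nonneg_nonneg)
  qed
  have G_mem: "(F, t) \<in> G" if "t \<ge> 0" "d \<in> D" "F = (\<lambda>i. t *\<^sub>R x i - d)" for F t d
    using that unfolding G_def by blast
  have G_elim: "\<exists>d\<in>D. t \<ge> 0 \<and> F = (\<lambda>i. t *\<^sub>R x i - d)" if "(F, t) \<in> G" for F t
    using that unfolding G_def by blast
  have G0: "(0, 0) \<in> G"
    by (rule G_mem[of 0 0]) (auto simp: subspace_0[OF D] zero_fun_def)
  have Gadd: "(F + F', s + t) \<in> G" if FF: "(F, s) \<in> G" "(F', t) \<in> G" for F s F' t
  proof -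
    obtain d e where "d \<in> D" "s \<ge> 0" "F = (\<lambda>i. s *\<^sub>R x i - d)" "e \<in> D" "t \<ge> 0" "F' = (\<lambda>i. t *\<^sub>R x i - e)"
      using G_elim[OF FF(1)] G_elim[OF FF(2)] by blast
    moreover from this have "F + F' = (\<lambda>i. (s + t) *\<^sub>R x i - (d + e))"
      by (simp only: fun_eq_iff plus_fun_apply) (simp add: scaleR_add_left)
    ultimately show ?thesis by (intro G_mem[of _ "d + e"] subspace_add[OF D]) simp_all
  qed
  have Gscale: "(sc c F, c * s) \<in> G" if F: "(F, s) \<in> G" and c: "c \<ge> 0" for F s c
  proof -
    obtain d where "d \<in> D" "s \<ge> 0" "F = (\<lambda>i. s *\<^sub>R x i - d)" using G_elim[OF F] by blast
    then show ?thesis using c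
      by (intro G_mem[of _ "c *\<^sub>R d"]) (auto simp: sc_def algebra_simps intro: subspace_scale[OF D])
  qed
  have Gle: "t \<le> p F" if F: "(F, t) \<in> G" for F t
  proof (rule ccontr)
    assume less: "\<not> t \<le> p F"
    obtain d where d: "d \<in> D" "t \<ge> 0" "F = (\<lambda>i. t *\<^sub>R x i - d)" using G_elim[OF F] by blast
    have t: "t > 0" using less p_nonneg[of F] by simp
    obtain i where i: "i \<in> I" "norm (x i - (1 / t) *\<^sub>R d) > R i"
      using disjoint[OF subspace_scale[OF D d(1)]] by blast
    have "t * norm (x i - (1 / t) *\<^sub>R d) = norm (t *\<^sub>R (x i - (1 / t) *\<^sub>R d))" using t by simp
    also have "\<dots> = norm (F i)" using t d(3) by (simp add: scaleR_diff_right)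
    also have "\<dots> \<le> p F * R i" by (rule p_bound[OF i(1)])
    also have "\<dots> \<le> t * R i" using less R[OF i(1)] by (intro mult_right_mono) auto
    finally show False using i(2) t by simp
  qed
  have "\<exists>\<phi>. (\<forall>F F'. \<phi> (F + F') = \<phi> F + \<phi> F') \<and> (\<forall>t F. \<phi> (sc t F) = t * \<phi> F) \<and>
      (\<forall>F. \<phi> F \<le> p F) \<and> (\<forall>(F, s)\<in>G. s \<le> \<phi> F)"
    by (rule hahn_banach_sandwich[OF vs sub G0 Gadd Gscale Gle])
  then obtain \<phi> where \<phi>_all: "\<forall>F F'. \<phi> (F + F') = \<phi> F + \<phi> F'" "\<forall>t F. \<phi> (sc t F) = t * \<phi> F"
    "\<forall>F. \<phi> F \<le> p F" "\<forall>(F, s)\<in>G. s \<le> \<phi> F"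
    by (elim exE conjE)
  note \<phi> = \<phi>_all(1-3)[rule_format]
  have \<phi>G: "s \<le> \<phi> F" if "(F, s) \<in> G" for F s using bspec[OF \<phi>_all(4) that] by simp
  have \<phi>_minus: "\<phi> (\<lambda>i. - F i) = - \<phi> F" for F
    using \<phi>(2)[of "-1" F] by (simp add: sc_def)
  define f where "f i a = \<phi> (\<lambda>j. if j = i then a else 0)" for i a
  have lin: "linear (f i)" for i
  proof (rule linearI)
    show "f i (a + b) = f i a + f i b" for a b
      unfolding f_def \<phi>(1)[symmetric] by (rule arg_cong[of _ _ \<phi>]) auto
    show "f i (c *\<^sub>R a) = c *\<^sub>R f i a" for c a
      unfolding f_def real_scaleR_def \<phi>(2)[symmetric] sc_def by (rule arg_cong[of _ _ \<phi>]) auto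
  qed
  have partial: "\<phi> (\<lambda>j. if j \<in> S then F j else 0) = (\<Sum>i\<in>S. f i (F i))" if "finite S" for S F
    using that
  proof induction
    case empty
    have "\<phi> (sc 0 (\<lambda>j. 0)) = 0 * \<phi> (\<lambda>j. 0)" by (rule \<phi>(2))
    then show ?case by (simp add: sc_def)
  next
    case (insert i S)
    have "\<phi> (\<lambda>j. if j \<in> insert i S then F j else 0) =
        \<phi> ((\<lambda>j. if j = i then F i else 0) + (\<lambda>j. if j \<in> S then F j else 0))"
      using insert.hyps by (intro arg_cong[of _ _ \<phi>]) auto
    then show ?case using insert by (simp add: \<phi>(1) f_def)
  qed
  have \<phi>_eq: "\<phi> F = (\<Sum>i\<in>I. f i (F i))" for F
  proof -
    let ?rest = "\<lambda>j. if j \<in> I then 0 else F j"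
    \<comment> \<open>The gauge ignores the coordinates outside \<open>I\<close>, hence so does \<open>\<phi>\<close>.\<close>
    have "p ?rest \<le> 0" "p (\<lambda>i. - ?rest i) \<le> 0" unfolding p_le_iff by auto
    then have "\<phi> ?rest = 0"
      using \<phi>(3)[of ?rest] \<phi>(3)[of "\<lambda>i. - ?rest i"] \<phi>_minus[of ?rest] by linarith
    moreover have "\<phi> F = \<phi> (?rest + (\<lambda>j. if j \<in> I then F j else 0))"
      by (rule arg_cong[of _ _ \<phi>]) auto
    ultimately show ?thesis using partial[OF I, of F] by (simp add: \<phi>(1))
  qed
  have "(\<Sum>i\<in>I. f i z) = 0" if z: "z \<in> D" for z
  proof -
    have "0 \<le> \<phi> (\<lambda>i. - z)" by (rule \<phi>G, rule G_mem[of _ z]) (auto simp: z)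
    moreover have "0 \<le> \<phi> (\<lambda>i. z)"
      by (rule \<phi>G, rule G_mem[of _ "- z"]) (auto simp: subspace_neg[OF D z])
    ultimately show ?thesis using \<phi>_minus[of "\<lambda>i. z"] \<phi>_eq[of "\<lambda>i. z"] by simp
  qed
  moreover have "1 \<le> (\<Sum>i\<in>I. f i (x i))"
    unfolding \<phi>_eq[symmetric] by (rule \<phi>G, rule G_mem[of _ 0]) (auto simp: subspace_0[OF D])
  moreover have "(\<Sum>i\<in>I. f i (u i)) \<le> 1" if "\<forall>i\<in>I. norm (u i) \<le> R i" for u
    unfolding \<phi>_eq[symmetric] using that by (intro order.trans[OF \<phi>(3)]) (simp add: p_le_iff)
  ultimately show ?thesis using lin by (intro exI[of _ f]) blast
qed

section \<open>L-projections onto annihilators\<close>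

lemma sum_functions_apply: "(sum F A) x = (\<Sum>i\<in>A. F i x)"
  by (induction A rule: infinite_finite_induct) auto

context banach_over
begin

lemma dual_sum:
  assumes "\<And>i. i \<in> A \<Longrightarrow> F i \<in> dual_space smul X"
  shows "sum F A \<in> dual_space smul X"
  using assms
proof (induction A rule: infinite_finite_induct)
  case (insert i A)
  then show ?case
    unfolding sum.insert[OF insert.hyps] by (intro dual_add) (blast intro: insert.IH)+
qed (use dual_zero in \<open>auto simp: zero_fun_def\<close>)

lemma associated_projection_props:
  assumes "associated_L_projection smul X J Q"
  shows associated_in_annihilator: "\<And>f. f \<in> dual_space smul X \<Longrightarrow> Q f \<in> annihilator smul X J"
    and associated_add: "\<And>f g. f \<in> dual_space smul X \<Longrightarrow> g \<in> dual_space smul X \<Longrightarrow> Q (f + g) = Q f + Q g"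
    and associated_scale: "\<And>c f. f \<in> dual_space smul X \<Longrightarrow> Q (dual_scale c f) = dual_scale c (Q f)"
    and associated_fixes: "\<And>f. f \<in> annihilator smul X J \<Longrightarrow> Q f = f"
    and associated_norm: "\<And>f. f \<in> dual_space smul X \<Longrightarrow>
      dual_norm X f = dual_norm X (Q f) + dual_norm X (f - Q f)"
proof -
  have im: "Q ` dual_space smul X = annihilator smul X J"
    and L: "L_projection (dual_space smul X) dual_scale (dual_norm X) Q"
    using assms by (auto simp: associated_L_projection_def)
  show "\<And>f. f \<in> dual_space smul X \<Longrightarrow> Q f \<in> annihilator smul X J" using im by blast
  show "\<And>f. f \<in> annihilator smul X J \<Longrightarrow> Q f = f"
    using im L unfolding L_projection_def by (metis imageE)
qed (use assms in \<open>auto simp: associated_L_projection_def L_projection_def\<close>)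

lemma annihilatorD:
  assumes "f \<in> annihilator smul X J"
  shows "f \<in> dual_space smul X" "\<And>x. x \<in> J \<Longrightarrow> f x = 0"
  using assms by (auto simp: annihilator_def)

lemma associated_diff:
  assumes Q: "associated_L_projection smul X J Q"
    and f: "f \<in> dual_space smul X" and g: "g \<in> dual_space smul X"
  shows "Q (f - g) = Q f - Q g"
proof -
  have "Q ((f - g) + g) = Q (f - g) + Q g" by (rule associated_add[OF Q dual_diff[OF f g] g])
  then show ?thesis by simp
qed

lemma associated_sum:
  assumes Q: "associated_L_projection smul X J Q" and "finite A"
    and "\<And>i. i \<in> A \<Longrightarrow> F i \<in> dual_space smul X"
  shows "Q (sum F A) = (\<Sum>i\<in>A. Q (F i))"
  using assms(2,3)
proof (induction A)
  case empty
  have "0 \<in> dual_space smul X" using dual_zero by (simp add: zero_fun_def)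
  then have "Q (0 - 0) = Q 0 - Q 0" by (intro associated_diff[OF Q])
  then show ?case by (simp only: sum.empty diff_self)
next
  case (insert i A)
  then have "Q (F i + sum F A) = Q (F i) + Q (sum F A)"
    by (intro associated_add[OF Q] dual_sum) auto
  moreover have "Q (sum F A) = (\<Sum>i\<in>A. Q (F i))" using insert by blast
  ultimately show ?case unfolding sum.insert[OF insert.hyps] by (rule trans[OF _ arg_cong])
qed

lemma real_subspace:
  assumes "module.subspace smul X"
  shows "real_vector.subspace X"
  using subspace_0[OF assms] subspace_add[OF assms] subspace_scale[OF assms, of _ "of_real _"]
  unfolding real_vector.subspace_def by (auto simp only: scale_of_real)

section \<open>Simultaneous M-ideals have the ball property\<close>

text \<open>
  The restriction of \<open>f\<close> to \<open>X2\<close> lies in the annihilator of \<open>J2\<close>, which \<open>Q2\<close>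
  fixes.  By commutation the restriction of \<open>Q1 f\<close> is the same functional.
\<close>

lemma complement_vanishes_of_commuting:
  assumes X2: "module.subspace smul X2" and "J2 \<subseteq> X2"
    and Q2: "associated_L_projection smul X2 J2 Q2"
    and comm: "\<And>f. f \<in> dual_space smul UNIV \<Longrightarrow> restr X2 (Q1 f) = Q2 (restr X2 f)"
    and f: "f \<in> dual_space smul UNIV" and f0: "\<And>z. z \<in> J2 \<Longrightarrow> f z = 0" and x: "x \<in> X2"
  shows "Q1 f x = f x"
proof -
  have "restr X2 f \<in> annihilator smul X2 J2"
    unfolding annihilator_def using dual_restr[OF f X2] f0 by (simp add: restr_def)
  then have "restr X2 (Q1 f) = restr X2 f"
    using comm[OF f] associated_fixes[OF Q2] by simp
  then show ?thesis using x by (simp add: restr_agree_iff)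
qed

text \<open>
  Each \<open>f i\<close> splits as \<open>Q1 (f i)\<close>, which does not distinguish \<open>x i\<close> from
  \<open>x i - y i\<close>, and a complementary part.  The complementary parts add up to a functional
  vanishing at \<open>x0\<close>, so each may be evaluated at \<open>x i - x0\<close> instead of \<open>x i\<close>.
  All the vectors now have norm at most \<open>r i\<close>, and since the norm is additive over the
  splitting, nothing is lost in recombining the two estimates.
\<close>

lemma functional_sum_bound:
  assumes f: "\<And>i. i \<in> I \<Longrightarrow> f i \<in> dual_space smul UNIV" and I: "finite I"
    and Q1: "associated_L_projection smul UNIV J1 Q1"
    and fix_at: "Q1 (sum f I) x0 = sum f I x0"
    and y: "\<And>i. i \<in> I \<Longrightarrow> y i \<in> J1" "\<And>i. i \<in> I \<Longrightarrow> norm (x i - y i) \<le> r i"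
    and x0: "\<And>i. i \<in> I \<Longrightarrow> norm (x i - x0) \<le> r i"
  shows "(\<Sum>i\<in>I. inner 1 (f i (x i))) \<le> (\<Sum>i\<in>I. dual_norm UNIV (f i) * r i)"
proof -
  let ?N = "\<lambda>k :: 'a \<Rightarrow> 'k. dual_norm UNIV k"
  have single: "inner 1 (f i (x i)) \<le> ?N (f i) * r i + inner 1 ((f i - Q1 (f i)) x0)"
    if i: "i \<in> I" for i
  proof -
    let ?g = "Q1 (f i)" and ?h = "f i - Q1 (f i)"
    have ann: "?g \<in> annihilator smul UNIV J1" by (rule associated_in_annihilator[OF Q1 f[OF i]])
    have g: "?g \<in> dual_space smul UNIV" "?g (y i) = 0"
      using annihilatorD[OF ann] y(1)[OF i] by auto
    have h: "?h \<in> dual_space smul UNIV" by (rule dual_diff[OF f[OF i] g(1)])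
    have est: "inner 1 (k (x i - w)) \<le> ?N k * r i"
      if k: "k \<in> dual_space smul UNIV" and w: "norm (x i - w) \<le> r i" for k w
    proof -
      have "inner 1 (k (x i - w)) \<le> norm (k (x i - w))" by (rule inner_one_le_norm)
      also have "\<dots> \<le> ?N k * norm (x i - w)" by (rule norm_le_dual_norm[OF k subspace_UNIV]) simp
      also have "\<dots> \<le> ?N k * r i"
        using w dual_norm_nonneg[OF k subspace_UNIV] by (rule mult_left_mono)
      finally show ?thesis .
    qed
    have "f i (x i) = ?g (x i - y i) + ?h (x i - x0) + ?h x0"
      using dual_diff_arg[OF g(1), of "x i" "y i"] dual_diff_arg[OF h, of "x i" x0] g(2) by simp
    then have "inner 1 (f i (x i)) =
        inner 1 (?g (x i - y i)) + inner 1 (?h (x i - x0)) + inner 1 (?h x0)"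
      by (simp only: inner_add_right)
    also have "\<dots> \<le> ?N ?g * r i + ?N ?h * r i + inner 1 (?h x0)"
      using est[OF g(1) y(2)[OF i]] est[OF h x0[OF i]] by linarith
    also have "\<dots> = ?N (f i) * r i + inner 1 (?h x0)"
      by (simp only: associated_norm[OF Q1 f[OF i]] distrib_right)
    finally show ?thesis .
  qed
  have "(\<Sum>i\<in>I. inner 1 ((f i - Q1 (f i)) x0)) = inner 1 (sum f I x0 - Q1 (sum f I) x0)"
    using associated_sum[OF Q1 I, of f] f
    by (simp add: sum_functions_apply inner_sum_right inner_diff_right sum_subtractf)
  then have "(\<Sum>i\<in>I. inner 1 ((f i - Q1 (f i)) x0)) = 0" by (simp add: fix_at)
  moreover have "(\<Sum>i\<in>I. inner 1 (f i (x i))) \<le>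
      (\<Sum>i\<in>I. ?N (f i) * r i + inner 1 ((f i - Q1 (f i)) x0))"
    by (intro sum_mono single)
  ultimately show ?thesis by (simp only: sum.distrib)
qed

text \<open>
  If the enlarged balls missed \<open>J2\<close>, the separating functionals would satisfy
  \<open>1 \<le> (\<Sum>i\<in>I. f i (x i)) \<le> (\<Sum>i\<in>I. norm (f i) * r i)\<close> by the
  previous estimate, while the same norms weighted with the larger radii \<open>r i + \<epsilon>\<close> sum
  to at most 1.
\<close>

lemma balls_meet_of_commuting:
  assumes X2: "module.subspace smul X2" and J2: "module.subspace smul J2" and "J2 \<subseteq> X2"
    and Q1: "associated_L_projection smul UNIV J1 Q1"
    and Q2: "associated_L_projection smul X2 J2 Q2"
    and comm: "\<And>f. f \<in> dual_space smul UNIV \<Longrightarrow> restr X2 (Q1 f) = Q2 (restr X2 f)"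
    and I: "finite (I :: nat set)" and r: "\<And>i. i \<in> I \<Longrightarrow> 0 < r i"
    and y: "\<And>i. i \<in> I \<Longrightarrow> y i \<in> J1" "\<And>i. i \<in> I \<Longrightarrow> norm (x i - y i) \<le> r i"
    and x0: "x0 \<in> X2" "\<And>i. i \<in> I \<Longrightarrow> norm (x i - x0) \<le> r i"
    and \<epsilon>: "\<epsilon> > 0"
  shows "\<exists>z\<in>J2. \<forall>i\<in>I. norm (x i - z) \<le> r i + \<epsilon>"
proof (rule ccontr)
  assume "\<not> ?thesis"
  then have disj: "\<exists>i\<in>I. norm (x i - z) > r i + \<epsilon>" if "z \<in> J2" for z
    using that by (meson not_le)
  define R where "R i = r i + \<epsilon>" for i
  have R: "R i > 0" "r i < R i" if "i \<in> I" for i using r[OF that] \<epsilon> by (auto simp: R_def)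
  have "\<exists>f :: nat \<Rightarrow> 'a \<Rightarrow> real. (\<forall>i. linear (f i)) \<and> (\<forall>z\<in>J2. (\<Sum>i\<in>I. f i z) = 0) \<and> 1 \<le> (\<Sum>i\<in>I. f i (x i)) \<and>
      (\<forall>u. (\<forall>i\<in>I. norm (u i) \<le> R i) \<longrightarrow> (\<Sum>i\<in>I. f i (u i)) \<le> 1)"
    using disj by (intro separate_balls_from_subspace I R(1) real_subspace J2) (auto simp: R_def)
  then obtain f :: "nat \<Rightarrow> 'a \<Rightarrow> real" where f: "\<forall>i. linear (f i)" "\<forall>z\<in>J2. (\<Sum>i\<in>I. f i z) = 0" "1 \<le> (\<Sum>i\<in>I. f i (x i))"
    and f_le: "\<forall>u. (\<forall>i\<in>I. norm (u i) \<le> R i) \<longrightarrow> (\<Sum>i\<in>I. f i (u i)) \<le> 1"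
    by (elim exE conjE)
  have lin: "linear (f i)" for i using f(1) by blast
  have bound: "f i a \<le> (1 / R i) * norm a" if i: "i \<in> I" for i a
  proof (cases "a = 0")
    case True
    then show ?thesis by (simp add: linear_0[OF lin])
  next
    case False
    let ?u = "\<lambda>j. if j = i then (R i / norm a) *\<^sub>R a else 0"
    have "(\<Sum>j\<in>I. f j (?u j)) \<le> 1"
      using False R(1) i by (intro f_le[rule_format]) (auto intro: less_imp_le)
    also have "(\<Sum>j\<in>I. f j (?u j)) = (\<Sum>j\<in>I. if j = i then f i ((R i / norm a) *\<^sub>R a) else 0)"
      by (rule sum.cong) (auto simp: linear_0[OF lin])
    also have "\<dots> = R i / norm a * f i a" using I i by (simp add: linear_scale[OF lin])
    finally show ?thesis using False R(1)[OF i] by (simp add: field_simps)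
  qed
  have "\<exists>F\<in>dual_space smul UNIV. (\<forall>a. inner 1 (F a) = f i a) \<and> (\<forall>a. norm (F a) \<le> (1 / R i) * norm a)"
    if i: "i \<in> I" for i
    by (rule functional_of_real_part[of "f i" "1 / R i"])
      (simp_all only: bound[OF i] linear_add[OF lin] linear_scale[OF lin] real_scaleR_def)
  then have "\<forall>i\<in>I. \<exists>F. F \<in> dual_space smul UNIV \<and> (\<forall>a. inner 1 (F a) = f i a)" by blast
  then obtain F where F_all: "\<forall>i\<in>I. F i \<in> dual_space smul UNIV \<and> (\<forall>a. inner 1 (F i a) = f i a)"
    by (rule bchoice[elim_format]) (elim exE)
  have F: "F i \<in> dual_space smul UNIV" "inner 1 (F i a) = f i a" if "i \<in> I" for i a
    using F_all that by auto
  have sumF: "sum F I \<in> dual_space smul UNIV" by (rule dual_sum[OF F(1)])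
  have sum_zero: "sum F I z = 0" if z: "z \<in> J2" for z
  proof (rule scalar_eqI)
    fix c
    have "inner 1 (sum F I (smul c z)) = (\<Sum>i\<in>I. f i (smul c z))"
      by (simp add: sum_functions_apply inner_sum_right F(2))
    also have "\<dots> = 0" using f(2) subspace_scale[OF J2 z] by blast
    finally show "inner 1 (c * sum F I z) = inner 1 (c * 0)"
      using dual_spaceD(2)[OF sumF] by simp
  qed
  have "(\<Sum>i\<in>I. f i (x i)) = (\<Sum>i\<in>I. inner 1 (F i (x i)))" by (simp add: F(2))
  also have "\<dots> \<le> (\<Sum>i\<in>I. dual_norm UNIV (F i) * r i)"
    using complement_vanishes_of_commuting[OF X2 \<open>J2 \<subseteq> X2\<close> Q2 comm sumF sum_zero x0(1)]
    by (intro functional_sum_bound[OF F(1) I Q1 _ y x0(2)])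
  finally have ge1: "1 \<le> (\<Sum>i\<in>I. dual_norm UNIV (F i) * r i)" using f(3) by linarith
  \<comment> \<open>Since \<open>r i < R i\<close>, the ball of radius \<open>R i\<close> has a point where \<open>f i\<close> beats \<open>r i\<close> times its norm, unless that norm is 0.\<close>
  have "\<exists>u. norm u \<le> R i \<and> dual_norm UNIV (F i) * r i \<le> f i u \<and>
      (0 < dual_norm UNIV (F i) * r i \<longrightarrow> dual_norm UNIV (F i) * r i < f i u)" if i: "i \<in> I" for i
  proof (cases "dual_norm UNIV (F i) = 0")
    case True
    then show ?thesis using R(1)[OF i] by (intro exI[of _ 0]) (simp add: linear_0[OF lin])
  next
    case False
    then have pos: "dual_norm UNIV (F i) > 0"
      using dual_norm_nonneg[OF F(1)[OF i] subspace_UNIV] by simp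
    have "dual_norm UNIV (F i) * r i / R i < dual_norm UNIV (F i)"
      using pos R[OF i] by (simp add: pos_divide_less_eq)
    then obtain v where v: "norm v \<le> 1" "dual_norm UNIV (F i) * r i / R i < inner 1 (F i v)"
      using dual_norm_attained_up_to[OF F(1)[OF i] subspace_UNIV] by metis
    have "dual_norm UNIV (F i) * r i < f i (R i *\<^sub>R v)"
      using v(2) R(1)[OF i] F(2)[OF i, of v]
      by (simp add: linear_scale[OF lin] pos_divide_less_eq mult.commute)
    moreover have "norm (R i *\<^sub>R v) \<le> R i" using v(1) R(1)[OF i] by simp
    ultimately show ?thesis by (intro exI[of _ "R i *\<^sub>R v"]) simp
  qed
  then have "\<forall>i\<in>I. \<exists>u. norm u \<le> R i \<and> dual_norm UNIV (F i) * r i \<le> f i u \<and>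
      (0 < dual_norm UNIV (F i) * r i \<longrightarrow> dual_norm UNIV (F i) * r i < f i u)" by blast
  then obtain u where u: "\<forall>i\<in>I. norm (u i) \<le> R i \<and> dual_norm UNIV (F i) * r i \<le> f i (u i) \<and>
      (0 < dual_norm UNIV (F i) * r i \<longrightarrow> dual_norm UNIV (F i) * r i < f i (u i))"
    by (rule bchoice[elim_format]) (elim exE)
  have "\<exists>i\<in>I. 0 < dual_norm UNIV (F i) * r i"
  proof (rule ccontr)
    assume "\<not> ?thesis"
    then have "(\<Sum>i\<in>I. dual_norm UNIV (F i) * r i) \<le> 0" by (intro sum_nonpos) auto
    then show False using ge1 by simp
  qed
  then have "(\<Sum>i\<in>I. dual_norm UNIV (F i) * r i) < (\<Sum>i\<in>I. f i (u i))"
    using u by (intro sum_strict_mono_ex1[OF I]) auto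
  moreover have "(\<Sum>i\<in>I. f i (u i)) \<le> 1" using u f_le by blast
  ultimately show False using ge1 by simp
qed

section \<open>The ball property yields a simultaneous M-ideal\<close>

text \<open>
  Functionals in the kernel of \<open>Q1\<close> do not lose norm when restricted to \<open>J1\<close>: if \<open>k\<close> is a
  norm-preserving extension of the restriction of \<open>h\<close>, then \<open>k - h\<close> annihilates
  \<open>J1\<close>, so \<open>k = (k - h) + h\<close> is the splitting of \<open>k\<close> by \<open>Q1\<close>, and
  \<open>h\<close> cannot have a larger norm than \<open>k\<close>.
\<close>

lemma dual_norm_kernel:
  assumes J1: "module.subspace smul J1"
    and Q1: "associated_L_projection smul UNIV J1 Q1"
    and h: "h \<in> dual_space smul UNIV" and Qh: "Q1 h = 0"
  shows "dual_norm UNIV h \<le> dual_norm J1 (restr J1 h)"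
proof -
  have "restr J1 h \<in> dual_space smul J1" by (rule dual_restr[OF h J1])
  from hahn_banach_extension[OF J1 this] obtain k where k: "k \<in> dual_space smul UNIV"
    "\<forall>x\<in>J1. k x = restr J1 h x" "dual_norm UNIV k \<le> dual_norm J1 (restr J1 h)"
    by (elim bexE conjE)
  have "k - h \<in> annihilator smul UNIV J1"
    unfolding annihilator_def using dual_diff[OF k(1) h] k(2) by (simp add: restr_def)
  then have "k - h = Q1 (k - h)" using associated_fixes[OF Q1] by simp
  also have "\<dots> = Q1 k" using associated_diff[OF Q1 k(1) h] Qh by simp
  finally have Qk: "Q1 k = k - h" ..
  have "dual_norm UNIV k = dual_norm UNIV (k - h) + dual_norm UNIV h"
    using associated_norm[OF Q1 k(1)] unfolding Qk by simp
  then show ?thesis using k(3) dual_norm_nonneg[OF dual_diff[OF k(1) h] subspace_UNIV] by linarith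
qed

text \<open>
  Choose \<open>y\<close> in the unit ball of \<open>J1\<close> with \<open>h y\<close> nearly real and equal to the norm
  of \<open>h\<close>.  As \<open>h\<close> vanishes at \<open>z\<close>, the value \<open>h (x + y - z) = h x + h y\<close>
  has real part at most the norm of \<open>h\<close>, up to an arbitrarily small error.  This leaves no room
  for a positive real part of \<open>h x\<close>, for any \<open>x\<close> in the unit ball of \<open>X2\<close>.
\<close>

lemma kernel_functional_vanishes:
  assumes J1: "module.subspace smul J1" and X2: "module.subspace smul X2"
    and Q1: "associated_L_projection smul UNIV J1 Q1"
    and h: "h \<in> dual_space smul UNIV" and Qh: "Q1 h = 0" and h0: "\<And>z. z \<in> J2 \<Longrightarrow> h z = 0"
    and approx: "\<forall>y\<in>cball 0 1 \<inter> J1. \<forall>x\<in>cball 0 1 \<inter> X2. \<forall>\<epsilon>>0. \<exists>z\<in>J2. norm (x + y - z) \<le> 1 + \<epsilon>"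
    and x: "x \<in> X2"
  shows "h x = 0"
proof -
  let ?N = "dual_norm UNIV h"
  have N: "?N \<ge> 0" by (rule dual_norm_nonneg[OF h subspace_UNIV])
  have hJ: "restr J1 h \<in> dual_space smul J1" by (rule dual_restr[OF h J1])
  have nonpos: "inner 1 (h w) \<le> 0" if w: "w \<in> X2" "norm w \<le> 1" for w
  proof (rule field_le_epsilon)
    fix e :: real assume e: "e > 0"
    \<comment> \<open>Half of the error \<open>e\<close> is spent on \<open>y\<close>, the other half on \<open>\<epsilon>\<close>; adding 1 in its denominator covers \<open>h = 0\<close>.\<close>
    have "?N - e / 2 < dual_norm J1 (restr J1 h)"
      using dual_norm_kernel[OF J1 Q1 h Qh] e by linarith
    then obtain y where y: "y \<in> J1" "norm y \<le> 1" "?N - e / 2 < inner 1 (restr J1 h y)"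
      using dual_norm_attained_up_to[OF hJ J1] by metis
    define \<epsilon> where "\<epsilon> = e / (2 * (?N + 1))"
    have \<epsilon>: "\<epsilon> > 0" "?N * \<epsilon> \<le> e / 2" using e N by (auto simp: \<epsilon>_def field_simps)
    obtain z where z: "z \<in> J2" "norm (w + y - z) \<le> 1 + \<epsilon>"
      using approx[rule_format, of y w \<epsilon>] y(1,2) w \<epsilon>(1) by auto
    have "h (w + y - z) = h w + h y"
      using dual_diff_arg[OF h] dual_spaceD(1)[OF h] h0[OF z(1)] by simp
    then have "inner 1 (h w) + inner 1 (h y) = inner 1 (h (w + y - z))" by (simp add: inner_add_right)
    also have "\<dots> \<le> norm (h (w + y - z))" by (rule inner_one_le_norm)
    also have "\<dots> \<le> ?N * norm (w + y - z)" by (rule norm_le_dual_norm[OF h subspace_UNIV]) simp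
    also have "\<dots> \<le> ?N * (1 + \<epsilon>)" using z(2) N by (rule mult_left_mono)
    also have "\<dots> \<le> ?N + e / 2" using \<epsilon>(2) by (simp add: distrib_left)
    finally show "inner 1 (h w) \<le> 0 + e" using y(1,3) by (simp add: restr_def)
  qed
  obtain c where c: "norm c = 1" "inner 1 (c * h x) = norm (h x)"
    by (rule scalar_rotate_to_norm)
  show ?thesis
  proof (cases "x = 0")
    case True
    then show ?thesis using dual_spaceD(2)[OF h, of x 0] by simp
  next
    case False
    \<comment> \<open>Normalise \<open>x\<close> and rotate it so that the bound on the real part bounds the norm.\<close>
    let ?w = "smul (of_real (1 / norm x) * c) x"
    have "norm ?w \<le> 1" using c(1) False by (simp add: norm_scale norm_mult norm_divide)
    then have "inner 1 (h ?w) \<le> 0" by (intro nonpos subspace_scale[OF X2 x])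
    also have "h ?w = (1 / norm x) *\<^sub>R (c * h x)"
      using dual_spaceD(2)[OF h] by (simp add: scaleR_conv_of_real)
    finally show ?thesis using c(2) False by (simp add: divide_le_0_iff)
  qed
qed

text \<open>
  The previous lemma applies to \<open>f - Q1 f\<close>: it vanishes on \<open>J2\<close> because \<open>Q1 f\<close>
  annihilates the larger space \<open>J1\<close>.
\<close>

lemma complement_vanishes_of_approximation:
  assumes J1: "module.subspace smul J1" and X2: "module.subspace smul X2" and "J2 \<subseteq> J1"
    and Q1: "associated_L_projection smul UNIV J1 Q1"
    and approx: "\<forall>y\<in>cball 0 1 \<inter> J1. \<forall>x\<in>cball 0 1 \<inter> X2. \<forall>\<epsilon>>0. \<exists>z\<in>J2. norm (x + y - z) \<le> 1 + \<epsilon>"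
    and f: "f \<in> dual_space smul UNIV" and f0: "\<And>z. z \<in> J2 \<Longrightarrow> f z = 0" and x: "x \<in> X2"
  shows "Q1 f x = f x"
proof -
  have ann: "Q1 f \<in> annihilator smul UNIV J1" by (rule associated_in_annihilator[OF Q1 f])
  note g = annihilatorD[OF ann]
  have "Q1 (f - Q1 f) = 0"
    using associated_diff[OF Q1 f g(1)] associated_fixes[OF Q1 ann] by simp
  then have "(f - Q1 f) x = 0"
    using f0 g(2) \<open>J2 \<subseteq> J1\<close>
    by (intro kernel_functional_vanishes[OF J1 X2 Q1 dual_diff[OF f g(1)] _ _ approx x]) auto
  then show ?thesis by simp
qed

text \<open>
  Commutation dictates that \<open>Q2\<close> extends a functional to the whole space, applies \<open>Q1\<close>
  and restricts.  By the previous lemma the choice of the extension does not matter, which makes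
  \<open>Q2\<close> linear and idempotent, and every functional annihilating \<open>J2\<close> is fixed.  A
  norm-preserving extension shows that the norm is additive.
\<close>

lemma simultaneous_of_approximation:
  assumes J1: "module.subspace smul J1" and X2: "module.subspace smul X2"
    and J2: "module.subspace smul J2" and J21: "J2 \<subseteq> J1" and J2X2: "J2 \<subseteq> X2"
    and Q1: "associated_L_projection smul UNIV J1 Q1"
    and approx: "\<forall>y\<in>cball 0 1 \<inter> J1. \<forall>x\<in>cball 0 1 \<inter> X2. \<forall>\<epsilon>>0. \<exists>z\<in>J2. norm (x + y - z) \<le> 1 + \<epsilon>"
  shows "\<exists>Q2. associated_L_projection smul X2 J2 Q2 \<and>
    (\<forall>f\<in>dual_space smul UNIV. restr X2 (Q1 f) = Q2 (restr X2 f))"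
proof -
  let ?U = "dual_space smul UNIV" and ?V = "dual_space smul X2"
  let ?N = "\<lambda>f :: 'a \<Rightarrow> 'k. dual_norm X2 f"
  have Q1_dual: "Q1 f \<in> ?U" "\<And>z. z \<in> J1 \<Longrightarrow> Q1 f z = 0" if "f \<in> ?U" for f
    using annihilatorD[OF associated_in_annihilator[OF Q1 that]] by auto
  note vanish = complement_vanishes_of_approximation[OF J1 X2 J21 Q1 approx]
  have agree: "restr X2 (Q1 f) = restr X2 (Q1 g)"
    if f: "f \<in> ?U" and g: "g \<in> ?U" and eq: "\<And>x. x \<in> X2 \<Longrightarrow> f x = g x" for f g
  proof -
    have "Q1 f x = Q1 g x" if x: "x \<in> X2" for x
    proof -
      have "(f - g) z = 0" if "z \<in> J2" for z using eq[of z] that J2X2 by auto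
      then have "Q1 (f - g) x = (f - g) x" by (intro vanish dual_diff f g x)
      then show ?thesis using eq[OF x] by (simp add: associated_diff[OF Q1 f g])
    qed
    then show ?thesis by (simp add: restr_agree_iff)
  qed
  have "\<forall>g\<in>?V. \<exists>f. f \<in> ?U \<and> (\<forall>x\<in>X2. f x = g x) \<and> dual_norm UNIV f \<le> ?N g"
  proof
    fix g assume "g \<in> ?V"
    from hahn_banach_extension[OF X2 this]
    show "\<exists>f. f \<in> ?U \<and> (\<forall>x\<in>X2. f x = g x) \<and> dual_norm UNIV f \<le> ?N g"
      by (simp only: Bex_def)
  qed
  then obtain ext where ext_all:
    "\<forall>g\<in>?V. ext g \<in> ?U \<and> (\<forall>x\<in>X2. ext g x = g x) \<and> dual_norm UNIV (ext g) \<le> ?N g"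
    by (rule bchoice[elim_format]) (elim exE)
  have ext: "ext g \<in> ?U" "\<And>x. x \<in> X2 \<Longrightarrow> ext g x = g x" "dual_norm UNIV (ext g) \<le> ?N g"
    if "g \<in> ?V" for g
    using bspec[OF ext_all that] by auto
  define Q2 where "Q2 g = restr X2 (Q1 (ext g))" for g
  have Q2_eq: "Q2 g = restr X2 (Q1 f)"
    if "g \<in> ?V" "f \<in> ?U" "\<And>x. x \<in> X2 \<Longrightarrow> f x = g x" for f g
    unfolding Q2_def by (rule agree[OF ext(1)[OF that(1)] that(2)]) (simp add: ext(2) that)
  have Q2_dual: "Q2 g \<in> ?V" if "g \<in> ?V" for g
    unfolding Q2_def by (intro dual_restr Q1_dual ext that X2)
  have Q2_zero: "Q2 g z = 0" if "g \<in> ?V" "z \<in> J2" for g z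
    using Q1_dual(2)[OF ext(1)[OF that(1)]] that(2) J21 by (auto simp: Q2_def restr_def)
  have add: "Q2 (g + g') = Q2 g + Q2 g'" if g: "g \<in> ?V" "g' \<in> ?V" for g g'
  proof -
    have "Q2 (g + g') = restr X2 (Q1 (ext g + ext g'))"
      using g by (intro Q2_eq dual_add ext(1)) (simp_all add: ext(2))
    then show ?thesis
      unfolding associated_add[OF Q1 ext(1)[OF g(1)] ext(1)[OF g(2)]]
      by (simp add: Q2_def restr_def fun_eq_iff)
  qed
  have scale: "Q2 (dual_scale c g) = dual_scale c (Q2 g)" if g: "g \<in> ?V" for c g
  proof -
    have "Q2 (dual_scale c g) = restr X2 (Q1 (dual_scale c (ext g)))"
      using g by (intro Q2_eq dual_dual_scale ext(1)) (simp_all add: ext(2) dual_scale_def)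
    then show ?thesis
      unfolding associated_scale[OF Q1 ext(1)[OF g]]
      by (simp add: Q2_def restr_def dual_scale_def fun_eq_iff)
  qed
  have idem: "Q2 (Q2 g) = Q2 g" if g: "g \<in> ?V" for g
  proof -
    have "Q2 (Q2 g) = restr X2 (Q1 (Q1 (ext g)))"
      by (rule Q2_eq[OF Q2_dual[OF g] Q1_dual(1)[OF ext(1)[OF g]]]) (simp add: Q2_def restr_def)
    then show ?thesis
      using associated_fixes[OF Q1 associated_in_annihilator[OF Q1 ext(1)[OF g]]]
      by (simp add: Q2_def)
  qed
  have norm: "?N g = ?N (Q2 g) + ?N (g - Q2 g)" if g: "g \<in> ?V" for g
  proof (rule antisym)
    have "?N (Q2 g + (g - Q2 g)) \<le> ?N (Q2 g) + ?N (g - Q2 g)"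
      by (intro dual_norm_triangle Q2_dual dual_diff g X2)
    then show "?N g \<le> ?N (Q2 g) + ?N (g - Q2 g)" by simp
    let ?f = "ext g"
    have f: "?f \<in> ?U" by (rule ext(1)[OF g])
    have "g - Q2 g = restr X2 (?f - Q1 ?f)"
      using ext(2)[OF g] dual_spaceD(3)[OF g] by (simp add: Q2_def restr_def fun_eq_iff)
    then have "?N (Q2 g) + ?N (g - Q2 g) \<le> dual_norm UNIV (Q1 ?f) + dual_norm UNIV (?f - Q1 ?f)"
      unfolding Q2_def
      by (simp only: add_mono[OF dual_norm_restr_le[OF Q1_dual(1)[OF f] X2]
            dual_norm_restr_le[OF dual_diff[OF f Q1_dual(1)[OF f]] X2]])
    also have "\<dots> \<le> ?N g" using associated_norm[OF Q1 f] ext(3)[OF g] by simp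
    finally show "?N (Q2 g) + ?N (g - Q2 g) \<le> ?N g" .
  qed
  have "Q2 ` ?V = annihilator smul X2 J2"
  proof (intro equalityI subsetI)
    show "g \<in> annihilator smul X2 J2" if "g \<in> Q2 ` ?V" for g
      using that Q2_dual Q2_zero by (auto simp: annihilator_def)
    fix g assume ann: "g \<in> annihilator smul X2 J2"
    note g = annihilatorD[OF ann]
    have "ext g z = 0" if "z \<in> J2" for z using ext(2)[OF g(1)] g(2) that J2X2 by auto
    then have "Q1 (ext g) x = g x" if "x \<in> X2" for x
      using vanish[OF ext(1)[OF g(1)] _ that] ext(2)[OF g(1) that] by simp
    then have "Q2 g = g" using dual_spaceD(3)[OF g(1)] by (simp add: Q2_def restr_def fun_eq_iff)
    then show "g \<in> Q2 ` ?V" by (intro image_eqI[of _ _ g] g(1)) simp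
  qed
  moreover have "L_projection ?V dual_scale (dual_norm X2) Q2"
    unfolding L_projection_def
    by (intro conjI ballI allI image_subsetI Q2_dual add scale idem norm)
  moreover have "restr X2 (Q1 f) = Q2 (restr X2 f)" if f: "f \<in> ?U" for f
    by (rule Q2_eq[symmetric, OF dual_restr[OF f X2] f]) (simp add: restr_def)
  ultimately show ?thesis
    unfolding associated_L_projection_def by (intro exI[of _ Q2] conjI ballI)
qed

end

section \<open>Equivalence of the ball conditions\<close>

lemma ball_condition_of_simultaneous:
  assumes bo: "banach_over smul"
    and X2: "closed_subspace smul X2" and J2: "closed_subspace smul J2" and "J2 \<subseteq> X2"
    and sim: "simultaneous_M_ideal smul UNIV X2 J1 J2"
  shows "ball_condition n X2 J1 J2"
  unfolding ball_condition_def
proof (intro allI impI)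
  fix x :: "nat \<Rightarrow> 'b" and r :: "nat \<Rightarrow> real" and \<epsilon> :: real
  assume r: "\<forall>i\<in>{1..n}. r i > 0" and y: "\<forall>i\<in>{1..n}. cball (x i) (r i) \<inter> J1 \<noteq> {}"
    and x0: "(\<Inter>i\<in>{1..n}. cball (x i) (r i)) \<inter> X2 \<noteq> {}" and \<epsilon>: "\<epsilon> > 0"
  interpret banach_over smul by fact
  obtain Q1 Q2 where Q: "associated_L_projection smul UNIV J1 Q1"
      "associated_L_projection smul X2 J2 Q2"
      "\<And>f. f \<in> dual_space smul UNIV \<Longrightarrow> restr X2 (Q1 f) = Q2 (restr X2 f)"
    using sim unfolding simultaneous_M_ideal_def by blast
  have "\<forall>i\<in>{1..n}. \<exists>w. w \<in> J1 \<and> norm (x i - w) \<le> r i"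
    using y by (auto simp: dist_norm)
  then obtain y where y: "\<forall>i\<in>{1..n}. y i \<in> J1 \<and> norm (x i - y i) \<le> r i"
    by (rule bchoice[elim_format]) (elim exE)
  obtain w where w: "w \<in> X2" "\<And>i. i \<in> {1..n} \<Longrightarrow> norm (x i - w) \<le> r i"
  proof -
    obtain w where "w \<in> (\<Inter>i\<in>{1..n}. cball (x i) (r i)) \<inter> X2" using x0 by blast
    then show thesis by (intro that[of w]) (auto simp: dist_norm)
  qed
  have "\<exists>z\<in>J2. \<forall>i\<in>{1..n}. norm (x i - z) \<le> r i + \<epsilon>"
    using X2 J2 r y
    by (intro balls_meet_of_commuting[OF _ _ \<open>J2 \<subseteq> X2\<close> Q _ _ _ _ w \<epsilon>, where y = y])
      (auto simp: closed_subspace_def)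
  then obtain z where "z \<in> (\<Inter>i\<in>{1..n}. cball (x i) (r i + \<epsilon>)) \<inter> J2" by (auto simp: dist_norm)
  then show "(\<Inter>i\<in>{1..n}. cball (x i) (r i + \<epsilon>)) \<inter> J2 \<noteq> {}" by blast
qed

lemma interior_ball_condition_of_ball_condition:
  assumes "ball_condition n X2 J1 J2"
  shows "interior_ball_condition n X2 J1 J2"
  unfolding interior_ball_condition_def
proof (intro allI impI)
  fix x :: "nat \<Rightarrow> 'a" and r :: "nat \<Rightarrow> real" and \<epsilon> :: real
  assume "\<forall>i\<in>{1..n}. r i > 0" "\<forall>i\<in>{1..n}. cball (x i) (r i) \<inter> J1 \<noteq> {}"
    and int: "interior (\<Inter>i\<in>{1..n}. cball (x i) (r i)) \<inter> X2 \<noteq> {}" and "\<epsilon> > 0"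
  moreover have "(\<Inter>i\<in>{1..n}. cball (x i) (r i)) \<inter> X2 \<noteq> {}"
    using int interior_subset by blast
  ultimately show "(\<Inter>i\<in>{1..n}. cball (x i) (r i + \<epsilon>)) \<inter> J2 \<noteq> {}"
    using assms unfolding ball_condition_def by blast
qed

text \<open>
  Balls of radius \<open>1 + \<epsilon> / 2\<close> about the points \<open>x + y\<^sub>i\<close> contain \<open>x\<close> in
  the interior of their intersection, and half of the permitted error is left for the conclusion.
\<close>

lemma three_translates_of_interior_ball_condition:
  assumes cond: "interior_ball_condition 3 X2 J1 J2"
    and y: "y1 \<in> cball 0 1 \<inter> J1" "y2 \<in> cball 0 1 \<inter> J1" "y3 \<in> cball 0 1 \<inter> J1"
    and x: "x \<in> cball 0 1 \<inter> X2" and \<epsilon>: "\<epsilon> > 0"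
  shows "\<exists>y\<in>J2. norm (x + y1 - y) \<le> 1 + \<epsilon> \<and> norm (x + y2 - y) \<le> 1 + \<epsilon> \<and> norm (x + y3 - y) \<le> 1 + \<epsilon>"
proof -
  define w where "w i = (if i = 1 then y1 else if i = 2 then y2 else y3)" for i :: nat
  have w: "w i \<in> J1" "norm (w i) \<le> 1" for i using y by (auto simp: w_def)
  have "(\<Inter>i\<in>{1..3}. cball (x + w i) ((1 + \<epsilon> / 2) + \<epsilon> / 2)) \<inter> J2 \<noteq> {}"
  proof (rule cond[unfolded interior_ball_condition_def, rule_format])
    show "cball (x + w i) (1 + \<epsilon> / 2) \<inter> J1 \<noteq> {}" for i
    proof -
      have "w i \<in> cball (x + w i) (1 + \<epsilon> / 2) \<inter> J1" using w x \<epsilon> by (simp add: dist_norm)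
      then show ?thesis by blast
    qed
    have "ball x (\<epsilon> / 2) \<subseteq> cball (x + w i) (1 + \<epsilon> / 2)" for i
    proof
      fix v assume "v \<in> ball x (\<epsilon> / 2)"
      then show "v \<in> cball (x + w i) (1 + \<epsilon> / 2)"
        using w(2)[of i] norm_triangle_ineq[of "x - v" "w i"] by (simp add: dist_norm algebra_simps)
    qed
    then have "ball x (\<epsilon> / 2) \<subseteq> interior (\<Inter>i\<in>{1..3}. cball (x + w i) (1 + \<epsilon> / 2))"
      by (intro interior_maximal) auto
    then have "x \<in> interior (\<Inter>i\<in>{1..3}. cball (x + w i) (1 + \<epsilon> / 2))" using \<epsilon> by auto
    then show "interior (\<Inter>i\<in>{1..3}. cball (x + w i) (1 + \<epsilon> / 2)) \<inter> X2 \<noteq> {}" using x by blast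
  qed (use \<epsilon> in auto)
  then obtain z where z: "z \<in> J2" "\<forall>i\<in>{1..3}. norm (x + w i - z) \<le> 1 + \<epsilon>"
    by (auto simp: dist_norm add.assoc)
  have "norm (x + w 1 - z) \<le> 1 + \<epsilon>" "norm (x + w 2 - z) \<le> 1 + \<epsilon>" "norm (x + w 3 - z) \<le> 1 + \<epsilon>"
    by (rule z(2)[rule_format], simp)+
  then show ?thesis using z(1) by (intro bexI[of _ z]) (simp_all add: w_def)
qed

text \<open>
  The condition on translates is reached from the three-ball condition and from the interior
  condition alike, through the interior condition for three balls.
\<close>

theorem theorem3p5:
  fixes smul :: "'k::{real_normed_field, euclidean_space} \<Rightarrow> 'a::banach \<Rightarrow> 'a"
    and X2 J1 J2 :: "'a set"
  assumes "banach_over smul"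
    and "closed_subspace smul X2"
    and "closed_subspace smul J1"
    and "closed_subspace smul J2" and "J2 \<subseteq> J1" and "J2 \<subseteq> X2"
    and "M_ideal smul UNIV J1"
  shows
    "(simultaneous_M_ideal smul UNIV X2 J1 J2 \<longleftrightarrow> (\<forall>n. ball_condition n X2 J1 J2)) \<and>
     (simultaneous_M_ideal smul UNIV X2 J1 J2 \<longleftrightarrow> ball_condition 3 X2 J1 J2) \<and>
     (simultaneous_M_ideal smul UNIV X2 J1 J2 \<longleftrightarrow>
        (\<forall>y1\<in>cball 0 1 \<inter> J1. \<forall>y2\<in>cball 0 1 \<inter> J1. \<forall>y3\<in>cball 0 1 \<inter> J1.
         \<forall>x\<in>cball 0 1 \<inter> X2. \<forall>\<epsilon>>0. \<exists>y\<in>J2.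
           norm (x + y1 - y) \<le> 1 + \<epsilon> \<and> norm (x + y2 - y) \<le> 1 + \<epsilon> \<and> norm (x + y3 - y) \<le> 1 + \<epsilon>)) \<and>
     (simultaneous_M_ideal smul UNIV X2 J1 J2 \<longleftrightarrow> (\<forall>n. interior_ball_condition n X2 J1 J2))"
    (is "(?i \<longleftrightarrow> ?ii) \<and> (?i \<longleftrightarrow> ?iii) \<and> (?i \<longleftrightarrow> ?iv) \<and> (?i \<longleftrightarrow> ?v)")
proof -
  interpret banach_over smul by fact
  have sub: "module.subspace smul X2" "module.subspace smul J1" "module.subspace smul J2"
    using assms(2-4) by (auto simp: closed_subspace_def)
  have i_ii: ?ii if ?i
    using ball_condition_of_simultaneous[OF assms(1,2,4,6) that] by (rule allI)
  have ii_v: ?v if ?ii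
    using that by (intro allI interior_ball_condition_of_ball_condition) (rule spec)
  have ii_iii: ?iii if ?ii using that by (rule spec)
  have iii_iv: ?iv if ?iii
    using interior_ball_condition_of_ball_condition[OF that]
    by (intro ballI allI impI) (rule three_translates_of_interior_ball_condition)
  have v_iv: ?iv if ?v
    using that[rule_format, of 3]
    by (intro ballI allI impI) (rule three_translates_of_interior_ball_condition)
  have iv_i: ?i if iv: ?iv
  proof -
    obtain Q1 where Q1: "associated_L_projection smul UNIV J1 Q1"
      using assms(7) by (auto simp: M_ideal_def)
    have "\<forall>y\<in>cball 0 1 \<inter> J1. \<forall>x\<in>cball 0 1 \<inter> X2. \<forall>\<epsilon>>0. \<exists>z\<in>J2. norm (x + y - z) \<le> 1 + \<epsilon>"
    proof (intro ballI allI impI)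
      fix y x and \<epsilon> :: real
      assume "y \<in> cball 0 1 \<inter> J1" "x \<in> cball 0 1 \<inter> X2" "\<epsilon> > 0"
      then have "\<exists>z\<in>J2. norm (x + y - z) \<le> 1 + \<epsilon> \<and> norm (x + y - z) \<le> 1 + \<epsilon> \<and> norm (x + y - z) \<le> 1 + \<epsilon>"
        by (intro iv[rule_format])
      then show "\<exists>z\<in>J2. norm (x + y - z) \<le> 1 + \<epsilon>" by auto
    qed
    then have "\<exists>Q2. associated_L_projection smul X2 J2 Q2 \<and>
        (\<forall>f\<in>dual_space smul UNIV. restr X2 (Q1 f) = Q2 (restr X2 f))"
      by (rule simultaneous_of_approximation[OF sub(2,1,3) assms(5,6) Q1])
    then obtain Q2 where Q2: "associated_L_projection smul X2 J2 Q2"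
        "\<forall>f\<in>dual_space smul UNIV. restr X2 (Q1 f) = Q2 (restr X2 f)"
      by (elim exE conjE)
    have "M_ideal smul X2 J2"
      unfolding M_ideal_def using assms(4,6) Q2(1) by (intro conjI exI[of _ Q2])
    then show ?i
      unfolding simultaneous_M_ideal_def using assms(7) Q1 Q2
      by (intro conjI exI[of _ Q1] exI[of _ Q2])
  qed
  have cycle: "(a \<longleftrightarrow> b) \<and> (a \<longleftrightarrow> c) \<and> (a \<longleftrightarrow> d) \<and> (a \<longleftrightarrow> e)"
    if "a \<Longrightarrow> b" "b \<Longrightarrow> c" "c \<Longrightarrow> d" "d \<Longrightarrow> a" "b \<Longrightarrow> e" "e \<Longrightarrow> d" for a b c d e
    using that by argo
  show ?thesis by (rule cycle[OF i_ii ii_iii iii_iv iv_i ii_v v_iv])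
qed

end
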